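(* Let $\omega$ be a nondegenerate $2$-form on a (necessarily even dimensional) smooth manifold $M$. There exists a symmetric connection in $M$ compatible with $\omega$ if and only if $\omega$ is closed, i.e. $\mathrm d\omega=0$. In this case, there are infinitely many symmetric connections in $M$ that are compatible with $\omega$.
   Context: A connection $\nabla$ in $M$ means a connection on the tangent bundle $TM$; it naturally induces connections on all tensor bundles over $M$, also denoted $\nabla$. The connection $\nabla$ is symmetric if its torsion $T(X,Y)=\nabla_XY-\nabla_YX-[X,Y]$ vanishes identically. The connection $\nabla$ is compatible with a tensor $\tau$ on $M$ if $\tau$ is $\nabla$-parallel, i.e. $\nabla\tau=0$.
   Formalization: The manifold M is taken nonempty and of positive dimension, since on a single point (with the zero form) there is exactly one connection and the last claim fails; the parenthetical remark that the dimension is even is not part of the formal claim. *)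

theory Defs
  imports "HOL-Analysis.Analysis"
begin

text \<open>
  A smooth manifold is a Hausdorff, second countable space (the type \<open>'a\<close>) together with a
  smooth atlas \<open>A\<close> modelled on a Euclidean space \<open>'b\<close>.  A chart is a pair \<open>(U, \<phi>)\<close> of its
  domain and its coordinate map; the values of \<open>\<phi>\<close> outside \<open>U\<close> are irrelevant.
  As types are nonempty and \<open>DIM('b) \<ge> 1\<close>, manifolds are nonempty and of positive dimension; on an
  empty or 0-dimensional manifold there is exactly one connection.
\<close>

fun Ck_on :: "nat \<Rightarrow> 'b::real_normed_vector set \<Rightarrow> ('b \<Rightarrow> 'c::real_normed_vector) \<Rightarrow> bool" where
  "Ck_on 0 S f \<longleftrightarrow> continuous_on S f"
| "Ck_on (Suc k) S f \<longleftrightarrow>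
     (\<forall>x\<in>S. f differentiable (at x)) \<and> (\<forall>v. Ck_on k S (\<lambda>x. frechet_derivative f (at x) v))"

text \<open>Only used for open \<open>S\<close> and a finite-dimensional domain.\<close>

definition smooth_on :: "'b::real_normed_vector set \<Rightarrow> ('b \<Rightarrow> 'c::real_normed_vector) \<Rightarrow> bool" where
  "smooth_on S f \<longleftrightarrow> (\<forall>k. Ck_on k S f)"

type_synonym ('a, 'b) atlas = "('a set \<times> ('a \<Rightarrow> 'b)) set"

definition smooth_atlas ::
    "('a::{t2_space, second_countable_topology}, 'b::euclidean_space) atlas \<Rightarrow> bool" where
  "smooth_atlas A \<longleftrightarrow>
     (\<Union>(U, \<phi>)\<in>A. U) = UNIV \<and>
     (\<forall>(U, \<phi>)\<in>A. open U \<and> open (\<phi> ` U) \<and> homeomorphism U (\<phi> ` U) \<phi> (inv_into U \<phi>)) \<and>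
     (\<forall>(U, \<phi>)\<in>A. \<forall>(V, \<psi>)\<in>A. smooth_on (\<phi> ` (U \<inter> V)) (\<psi> \<circ> inv_into U \<phi>))"

definition smooth_functions ::
    "('a::{t2_space, second_countable_topology}, 'b::euclidean_space) atlas \<Rightarrow> ('a \<Rightarrow> real) set" where
  "smooth_functions A = {f. \<forall>(U, \<phi>)\<in>A. smooth_on (\<phi> ` U) (f \<circ> inv_into U \<phi>)}"

text \<open>
  Tangent vectors at \<open>p\<close> are the derivations at \<open>p\<close> of the algebra of smooth functions.  They are
  represented by total functionals which vanish on non-smooth functions, so that each derivation
  has exactly one representative; the zero vector is \<open>\<lambda>f. 0\<close>.
\<close>

type_synonym 'a tvec = "('a \<Rightarrow> real) \<Rightarrow> real"
type_synonym 'a vfield = "'a \<Rightarrow> 'a tvec"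

definition tangent_space ::
    "('a::{t2_space, second_countable_topology}, 'b::euclidean_space) atlas \<Rightarrow> 'a \<Rightarrow> 'a tvec set" where
  "tangent_space A p = {v.
     (\<forall>f\<in>smooth_functions A. \<forall>g\<in>smooth_functions A. v (\<lambda>q. f q + g q) = v f + v g) \<and>
     (\<forall>f\<in>smooth_functions A. \<forall>c. v (\<lambda>q. c * f q) = c * v f) \<and>
     (\<forall>f\<in>smooth_functions A. \<forall>g\<in>smooth_functions A.
        v (\<lambda>q. f q * g q) = f p * v g + g p * v f) \<and>
     (\<forall>f. f \<notin> smooth_functions A \<longrightarrow> v f = 0)}"

definition vector_fields ::
    "('a::{t2_space, second_countable_topology}, 'b::euclidean_space) atlas \<Rightarrow> 'a vfield set" where
  "vector_fields A = {X.
     (\<forall>p. X p \<in> tangent_space A p) \<and>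
     (\<forall>f\<in>smooth_functions A. (\<lambda>p. X p f) \<in> smooth_functions A)}"

text \<open>The total functional \<open>lie_bracket A X Y p\<close> is cut off outside the smooth functions in order
  to be the chosen representative of the derivation \<open>f \<mapsto> X(Y f) - Y(X f)\<close> at \<open>p\<close>.\<close>

definition lie_bracket ::
    "('a::{t2_space, second_countable_topology}, 'b::euclidean_space) atlas
       \<Rightarrow> 'a vfield \<Rightarrow> 'a vfield \<Rightarrow> 'a vfield" where
  "lie_bracket A X Y = (\<lambda>p f.
     if f \<in> smooth_functions A then X p (\<lambda>q. Y q f) - Y p (\<lambda>q. X q f) else 0)"

text \<open>The values of \<open>\<omega> p\<close> on functionals which are not tangent vectors at \<open>p\<close> are irrelevant.\<close>

definition two_form ::
    "('a::{t2_space, second_countable_topology}, 'b::euclidean_space) atlas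
       \<Rightarrow> ('a \<Rightarrow> 'a tvec \<Rightarrow> 'a tvec \<Rightarrow> real) \<Rightarrow> bool" where
  "two_form A \<omega> \<longleftrightarrow>
     (\<forall>p. \<forall>u\<in>tangent_space A p. \<forall>v\<in>tangent_space A p. \<forall>w\<in>tangent_space A p. \<forall>a b.
        \<omega> p (\<lambda>f. a * u f + b * v f) w = a * \<omega> p u w + b * \<omega> p v w \<and>
        \<omega> p w (\<lambda>f. a * u f + b * v f) = a * \<omega> p w u + b * \<omega> p w v) \<and>
     (\<forall>p. \<forall>v\<in>tangent_space A p. \<omega> p v v = 0) \<and>
     (\<forall>X\<in>vector_fields A. \<forall>Y\<in>vector_fields A. (\<lambda>p. \<omega> p (X p) (Y p)) \<in> smooth_functions A)"

definition nondegenerate ::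
    "('a::{t2_space, second_countable_topology}, 'b::euclidean_space) atlas
       \<Rightarrow> ('a \<Rightarrow> 'a tvec \<Rightarrow> 'a tvec \<Rightarrow> real) \<Rightarrow> bool" where
  "nondegenerate A \<omega> \<longleftrightarrow>
     (\<forall>p. \<forall>u\<in>tangent_space A p. (\<forall>v\<in>tangent_space A p. \<omega> p u v = 0) \<longrightarrow> u = (\<lambda>f. 0))"

text \<open>The invariant formula for the exterior derivative of a 2-form, without the factor
  \<open>1/3\<close> used by some authors.\<close>

definition ext_deriv ::
    "('a::{t2_space, second_countable_topology}, 'b::euclidean_space) atlas
       \<Rightarrow> ('a \<Rightarrow> 'a tvec \<Rightarrow> 'a tvec \<Rightarrow> real)
       \<Rightarrow> 'a vfield \<Rightarrow> 'a vfield \<Rightarrow> 'a vfield \<Rightarrow> 'a \<Rightarrow> real" where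
  "ext_deriv A \<omega> X Y Z = (\<lambda>p.
       X p (\<lambda>q. \<omega> q (Y q) (Z q))
     - Y p (\<lambda>q. \<omega> q (X q) (Z q))
     + Z p (\<lambda>q. \<omega> q (X q) (Y q))
     - \<omega> p (lie_bracket A X Y p) (Z p)
     + \<omega> p (lie_bracket A X Z p) (Y p)
     - \<omega> p (lie_bracket A Y Z p) (X p))"

definition closed_form ::
    "('a::{t2_space, second_countable_topology}, 'b::euclidean_space) atlas
       \<Rightarrow> ('a \<Rightarrow> 'a tvec \<Rightarrow> 'a tvec \<Rightarrow> real) \<Rightarrow> bool" where
  "closed_form A \<omega> \<longleftrightarrow>
     (\<forall>X\<in>vector_fields A. \<forall>Y\<in>vector_fields A. \<forall>Z\<in>vector_fields A.
        ext_deriv A \<omega> X Y Z = (\<lambda>p. 0))"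

text \<open>
  Connections are total functions on pairs of fields; the last clause fixes their values when one
  of the arguments is not a smooth vector field.  Hence two connections are equal as functions iff
  they agree on all smooth vector fields, so that connections are counted correctly.
  Real-homogeneity in the second argument is the Leibniz rule for constant \<open>h\<close>.
\<close>

definition connection ::
    "('a::{t2_space, second_countable_topology}, 'b::euclidean_space) atlas
       \<Rightarrow> ('a vfield \<Rightarrow> 'a vfield \<Rightarrow> 'a vfield) \<Rightarrow> bool" where
  "connection A D \<longleftrightarrow>
     (\<forall>X\<in>vector_fields A. \<forall>Y\<in>vector_fields A. D X Y \<in> vector_fields A) \<and>
     (\<forall>X\<in>vector_fields A. \<forall>X'\<in>vector_fields A. \<forall>Y\<in>vector_fields A.
        D (\<lambda>p f. X p f + X' p f) Y = (\<lambda>p f. D X Y p f + D X' Y p f)) \<and>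
     (\<forall>h\<in>smooth_functions A. \<forall>X\<in>vector_fields A. \<forall>Y\<in>vector_fields A.
        D (\<lambda>p f. h p * X p f) Y = (\<lambda>p f. h p * D X Y p f)) \<and>
     (\<forall>X\<in>vector_fields A. \<forall>Y\<in>vector_fields A. \<forall>Y'\<in>vector_fields A.
        D X (\<lambda>p f. Y p f + Y' p f) = (\<lambda>p f. D X Y p f + D X Y' p f)) \<and>
     (\<forall>h\<in>smooth_functions A. \<forall>X\<in>vector_fields A. \<forall>Y\<in>vector_fields A.
        D X (\<lambda>p f. h p * Y p f) = (\<lambda>p f. X p h * Y p f + h p * D X Y p f)) \<and>
     (\<forall>X Y. X \<notin> vector_fields A \<or> Y \<notin> vector_fields A \<longrightarrow> D X Y = (\<lambda>p f. 0))"

definition torsion ::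
    "('a::{t2_space, second_countable_topology}, 'b::euclidean_space) atlas
       \<Rightarrow> ('a vfield \<Rightarrow> 'a vfield \<Rightarrow> 'a vfield) \<Rightarrow> 'a vfield \<Rightarrow> 'a vfield \<Rightarrow> 'a vfield" where
  "torsion A D X Y = (\<lambda>p f. D X Y p f - D Y X p f - lie_bracket A X Y p f)"

definition symmetric_connection ::
    "('a::{t2_space, second_countable_topology}, 'b::euclidean_space) atlas
       \<Rightarrow> ('a vfield \<Rightarrow> 'a vfield \<Rightarrow> 'a vfield) \<Rightarrow> bool" where
  "symmetric_connection A D \<longleftrightarrow> connection A D \<and>
     (\<forall>X\<in>vector_fields A. \<forall>Y\<in>vector_fields A. torsion A D X Y = (\<lambda>p f. 0))"

text \<open>\<open>cov_deriv D \<omega> X Y Z\<close> is the function \<open>(\<nabla>\<^sub>X \<omega>)(Y, Z)\<close> for the connection which \<open>D\<close> induces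
  on covariant 2-tensors.\<close>

definition cov_deriv ::
    "('a vfield \<Rightarrow> 'a vfield \<Rightarrow> 'a vfield) \<Rightarrow> ('a \<Rightarrow> 'a tvec \<Rightarrow> 'a tvec \<Rightarrow> real)
       \<Rightarrow> 'a vfield \<Rightarrow> 'a vfield \<Rightarrow> 'a vfield \<Rightarrow> 'a \<Rightarrow> real" where
  "cov_deriv D \<omega> X Y Z = (\<lambda>p.
     X p (\<lambda>q. \<omega> q (Y q) (Z q)) - \<omega> p (D X Y p) (Z p) - \<omega> p (Y p) (D X Z p))"

definition compatible ::
    "('a::{t2_space, second_countable_topology}, 'b::euclidean_space) atlas
       \<Rightarrow> ('a vfield \<Rightarrow> 'a vfield \<Rightarrow> 'a vfield) \<Rightarrow> ('a \<Rightarrow> 'a tvec \<Rightarrow> 'a tvec \<Rightarrow> real) \<Rightarrow> bool" where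
  "compatible A D \<omega> \<longleftrightarrow>
     (\<forall>X\<in>vector_fields A. \<forall>Y\<in>vector_fields A. \<forall>Z\<in>vector_fields A.
        cov_deriv D \<omega> X Y Z = (\<lambda>p. 0))"

end

theory Submission
  imports Defs
begin

text \<open>
  Let \<open>D\<close> be a symmetric connection and \<open>T(X, Y, Z) = (D\<^sub>X \<omega>)(Y, Z)\<close>, which is skew in \<open>Y, Z\<close>.
  Replacing every bracket in the invariant formula for \<open>d\<omega>\<close> by \<open>D\<^sub>X Y - D\<^sub>Y X\<close> gives
  \<open>d\<omega>(X, Y, Z) = T(X, Y, Z) + T(Y, Z, X) + T(Z, X, Y)\<close> (\<open>ext_deriv_eq_alternated_cov_deriv\<close>).
  Hence a compatible symmetric connection forces \<open>d\<omega> = 0\<close>.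

  Conversely, take any symmetric connection \<open>D\<close>.  As \<open>\<omega>\<close> is nondegenerate, there is a unique
  tensor \<open>S\<close> with \<open>\<omega>(S(X, Y), Z) = (T(X, Y, Z) + T(Y, X, Z)) / 3\<close>.  It is symmetric in \<open>X, Y\<close>, so
  \<open>D + S\<close> is again a symmetric connection, and the cyclic identity \<open>d\<omega> = 0\<close> is exactly what makes
  \<open>D + S\<close> compatible with \<open>\<omega>\<close> (\<open>closed_imp_compatible_exists\<close>).  Finally, for a vector field
  \<open>V \<noteq> 0\<close> the tensors \<open>S\<^sub>t(X, Y) = t \<omega>(V, X) \<omega>(V, Y) V\<close> have \<open>\<omega>(S\<^sub>t(X, Y), Z)\<close> totally symmetric, so
  adding them preserves symmetry and compatibility (\<open>infinitely_many_compatible\<close>).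

  Two facts about manifolds carry this argument.

  Existence of a symmetric connection: near every point there are smooth functions \<open>x\<^sub>b\<close> and vector
  fields \<open>E\<^sub>b\<close>, both defined on the whole manifold, with \<open>v = \<Sum>\<^sub>b v(x\<^sub>b) E\<^sub>b\<close> for all tangent vectors \<open>v\<close>
  (\<open>local_frame_exists\<close>); that every derivation has this form is Hadamard's lemma.  A partition of
  unity turns these into one countable, locally finite system \<open>x\<^sub>j, E\<^sub>j\<close> with \<open>v = \<Sum>\<^sub>j v(x\<^sub>j) E\<^sub>j\<close>
  everywhere (\<open>global_frame\<close>), and \<open>D\<^sub>X Y = \<Sum>\<^sub>j X(Y(x\<^sub>j)) E\<^sub>j\<close> is a symmetric connection: the Leibniz rule and
  the vanishing of the torsion are the expansions of \<open>Y\<close> and of \<open>[X, Y]\<close> in this system.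

  Smoothness of the musical isomorphism (\<open>sharp\<close>): a \<open>C\<^sup>\<infinity>\<close>-linear functional \<open>\<alpha>\<close> on vector fields is
  \<open>\<omega>(N, -)\<close> for a smooth \<open>N\<close>.  In a local frame this is a linear system with smooth coefficients whose
  matrix is invertible at the given point; Gaussian elimination solves it smoothly nearby, and
  uniqueness glues the local solutions without a partition of unity.
\<close>

section \<open>Calculus of smooth functions on open sets\<close>

lemma Ck_on_cong:
  assumes "open S" and "\<And>x. x \<in> S \<Longrightarrow> f x = g x" and "Ck_on k S f"
  shows "Ck_on k S g"
  using assms(2,3)
proof (induction k arbitrary: f g)
  case 0
  then show ?case by (simp cong: continuous_on_cong)
next
  case (Suc k)
  have D: "(g has_derivative frechet_derivative f (at x)) (at x)" if "x \<in> S" for x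
    using Suc.prems \<open>open S\<close> that
    by (auto intro: has_derivative_transform_within_open simp: frechet_derivative_works)
  moreover have "Ck_on k S (\<lambda>x. frechet_derivative g (at x) v)" for v
  proof (rule Suc.IH)
    show "Ck_on k S (\<lambda>x. frechet_derivative f (at x) v)" using Suc.prems by simp
    show "frechet_derivative f (at x) v = frechet_derivative g (at x) v" if "x \<in> S" for x
      using frechet_derivative_at[OF D[OF that]] by simp
  qed
  ultimately show ?case by (auto simp: differentiable_def)
qed

text \<open>
  The directional derivatives of \<open>f\<close> are \<^const>\<open>frechet_derivative\<close> in the definition of \<^const>\<open>Ck_on\<close>;
  here they may be replaced by any explicit formula that is valid on the open set.  The closure
  properties below are inductions on \<open>k\<close> that feed the usual differentiation rules to this rule.
\<close>

lemma Ck_on_SucI: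
  assumes "open S" and D: "\<And>x. x \<in> S \<Longrightarrow> (f has_derivative f' x) (at x)"
    and C: "\<And>v. Ck_on k S (\<lambda>x. f' x v)"
  shows "Ck_on (Suc k) S f"
proof -
  have "Ck_on k S (\<lambda>x. frechet_derivative f (at x) v)" for v
    by (rule Ck_on_cong[OF \<open>open S\<close> _ C]) (simp add: frechet_derivative_at[OF D, symmetric])
  then show ?thesis using D by (auto simp: differentiable_def)
qed

lemma Ck_on_SucD:
  assumes "Ck_on (Suc k) S f"
  shows "x \<in> S \<Longrightarrow> (f has_derivative frechet_derivative f (at x)) (at x)"
    and "Ck_on k S (\<lambda>x. frechet_derivative f (at x) v)"
  using assms by (auto simp: frechet_derivative_works)

lemma Ck_on_lower: "Ck_on (Suc k) S f \<Longrightarrow> Ck_on k S f"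
proof (induction k arbitrary: f)
  case 0
  then show ?case
    by (auto intro!: continuous_at_imp_continuous_on differentiable_imp_continuous_within)
next
  case (Suc k)
  from Suc.prems have "Ck_on (Suc k) S (\<lambda>x. frechet_derivative f (at x) v)" for v by simp
  with Suc show ?case by auto
qed

lemma Ck_on_const: "open S \<Longrightarrow> Ck_on k S (\<lambda>x. c)"
proof (induction k arbitrary: c)
  case (Suc k)
  then show ?case by (intro Ck_on_SucI[where f' = "\<lambda>x v. 0"]) auto
qed auto

lemma Ck_on_bounded_linear:
  assumes "open S" "bounded_linear L" "Ck_on k S f"
  shows "Ck_on k S (\<lambda>x. L (f x))"
  using assms(3)
proof (induction k arbitrary: f)
  case 0
  then show ?case using assms(2) by (simp add: bounded_linear.continuous_on)
next
  case (Suc k)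
  note D = Ck_on_SucD[OF Suc.prems]
  show ?case
    by (rule Ck_on_SucI[OF \<open>open S\<close> bounded_linear.has_derivative[OF assms(2) D(1)]])
       (auto intro: Suc.IH D)
qed

lemma Ck_on_add:
  assumes "open S" "Ck_on k S f" "Ck_on k S g"
  shows "Ck_on k S (\<lambda>x. f x + g x)"
  using assms(2,3)
proof (induction k arbitrary: f g)
  case (Suc k)
  note D = Ck_on_SucD[OF Suc.prems(1)] Ck_on_SucD[OF Suc.prems(2)]
  show ?case
    by (rule Ck_on_SucI[OF \<open>open S\<close> has_derivative_add[OF D(1) D(3)]]) (auto intro: Suc.IH D)
qed (auto intro: continuous_on_add)

lemma Ck_on_mult:
  fixes f g :: "'b::real_normed_vector \<Rightarrow> real"
  assumes "open S" "Ck_on k S f" "Ck_on k S g"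
  shows "Ck_on k S (\<lambda>x. f x * g x)"
  using assms(2,3)
proof (induction k arbitrary: f g)
  case (Suc k)
  note D = Ck_on_SucD[OF Suc.prems(1)] Ck_on_SucD[OF Suc.prems(2)]
  show ?case
    by (rule Ck_on_SucI[OF \<open>open S\<close> has_derivative_mult[OF D(1) D(3)]])
       (auto intro!: Ck_on_add Suc.IH D Ck_on_lower[OF Suc.prems(1)]
          Ck_on_lower[OF Suc.prems(2)] \<open>open S\<close>)
qed (auto intro: continuous_on_mult)

lemma Ck_on_inverse:
  fixes f :: "'b::real_normed_vector \<Rightarrow> real"
  assumes "open S" "Ck_on k S f" "\<And>x. x \<in> S \<Longrightarrow> f x \<noteq> 0"
  shows "Ck_on k S (\<lambda>x. inverse (f x))"
  using assms(2)
proof (induction k)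
  case 0
  then show ?case using assms(3) by (auto intro!: continuous_on_inverse)
next
  case (Suc k)
  note D = Ck_on_SucD[OF Suc.prems]
  have IH: "Ck_on k S (\<lambda>x. inverse (f x))" using Suc.IH Ck_on_lower[OF Suc.prems] .
  have neg: "Ck_on k S (\<lambda>x. - h x)" if "Ck_on k S h" for h :: "'b \<Rightarrow> real"
    using Ck_on_bounded_linear[OF \<open>open S\<close> bounded_linear_minus[OF bounded_linear_ident] that] .
  show ?case
    by (rule Ck_on_SucI[OF \<open>open S\<close> Deriv.has_derivative_inverse[OF assms(3) D(1)]])
       (auto intro!: Ck_on_mult IH D neg \<open>open S\<close>)
qed

lemma Ck_on_subset: "Ck_on k S f \<Longrightarrow> T \<subseteq> S \<Longrightarrow> Ck_on k T f"
  by (induction k arbitrary: f) (auto intro: continuous_on_subset)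

lemma Ck_on_local:
  assumes "\<And>x. x \<in> S \<Longrightarrow> \<exists>T. open T \<and> x \<in> T \<and> Ck_on k T f"
  shows "Ck_on k S f"
  using assms
proof (induction k arbitrary: f)
  case 0
  have "isCont f x" if "x \<in> S" for x
    using 0[OF that] by (auto simp: continuous_on_eq_continuous_at)
  then show ?case by (simp add: continuous_at_imp_continuous_on)
next
  case (Suc k)
  show ?case
    unfolding Ck_on.simps
  proof (intro conjI ballI allI)
    fix x assume "x \<in> S" then show "f differentiable at x" using Suc.prems[of x] by auto
  next
    fix v
    show "Ck_on k S (\<lambda>x. frechet_derivative f (at x) v)"
    proof (rule Suc.IH)
      fix x assume "x \<in> S"
      from Suc.prems[OF this] show "\<exists>T. open T \<and> x \<in> T \<and> Ck_on k T (\<lambda>x. frechet_derivative f (at x) v)"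
        by auto
    qed
  qed
qed

lemma smooth_on_cong:
  "open S \<Longrightarrow> (\<And>x. x \<in> S \<Longrightarrow> f x = g x) \<Longrightarrow> smooth_on S f \<Longrightarrow> smooth_on S g"
  unfolding smooth_on_def using Ck_on_cong by blast

lemma smooth_on_const: "open S \<Longrightarrow> smooth_on S (\<lambda>x. c)"
  by (simp add: smooth_on_def Ck_on_const)

lemma smooth_on_bounded_linear:
  "open S \<Longrightarrow> bounded_linear L \<Longrightarrow> smooth_on S f \<Longrightarrow> smooth_on S (\<lambda>x. L (f x))"
  by (simp add: smooth_on_def Ck_on_bounded_linear)

lemma smooth_on_add:
  "open S \<Longrightarrow> smooth_on S f \<Longrightarrow> smooth_on S g \<Longrightarrow> smooth_on S (\<lambda>x. f x + g x)"
  by (simp add: smooth_on_def Ck_on_add)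

lemma smooth_on_mult:
  fixes f g :: "'b::real_normed_vector \<Rightarrow> real"
  shows "open S \<Longrightarrow> smooth_on S f \<Longrightarrow> smooth_on S g \<Longrightarrow> smooth_on S (\<lambda>x. f x * g x)"
  by (simp add: smooth_on_def Ck_on_mult)

lemma smooth_on_diff:
  fixes f g :: "'b::real_normed_vector \<Rightarrow> real"
  shows "open S \<Longrightarrow> smooth_on S f \<Longrightarrow> smooth_on S g \<Longrightarrow> smooth_on S (\<lambda>x. f x - g x)"
  using smooth_on_add[of S f "\<lambda>x. -1 * g x"] smooth_on_mult[of S "\<lambda>x. -1" g]
  by (simp add: smooth_on_const)

lemma smooth_on_inverse:
  fixes f :: "'b::real_normed_vector \<Rightarrow> real"
  shows "open S \<Longrightarrow> smooth_on S f \<Longrightarrow> (\<And>x. x \<in> S \<Longrightarrow> f x \<noteq> 0) \<Longrightarrow> smooth_on S (\<lambda>x. inverse (f x))"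
  by (simp add: smooth_on_def Ck_on_inverse)

lemma smooth_on_sum:
  fixes f :: "'i \<Rightarrow> 'b::real_normed_vector \<Rightarrow> 'c::real_normed_vector"
  shows "open S \<Longrightarrow> (\<And>i. i \<in> I \<Longrightarrow> smooth_on S (f i)) \<Longrightarrow> smooth_on S (\<lambda>x. \<Sum>i\<in>I. f i x)"
  by (induction I rule: infinite_finite_induct) (auto intro: smooth_on_const smooth_on_add)

lemma smooth_on_subset: "smooth_on S f \<Longrightarrow> T \<subseteq> S \<Longrightarrow> smooth_on T f"
  by (auto simp: smooth_on_def intro: Ck_on_subset)

lemma smooth_on_local:
  "(\<And>x. x \<in> S \<Longrightarrow> \<exists>T. open T \<and> x \<in> T \<and> smooth_on T f) \<Longrightarrow> smooth_on S f"
  unfolding smooth_on_def by (meson Ck_on_local)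

lemma smooth_on_has_derivative:
  "smooth_on S f \<Longrightarrow> x \<in> S \<Longrightarrow> (f has_derivative frechet_derivative f (at x)) (at x)"
  unfolding smooth_on_def using Ck_on_SucD(1) by blast

lemma smooth_on_frechet_derivative:
  "smooth_on S f \<Longrightarrow> smooth_on S (\<lambda>x. frechet_derivative f (at x) v)"
  unfolding smooth_on_def using Ck_on_SucD(2) by blast

lemma smooth_on_imp_continuous_on: "smooth_on S f \<Longrightarrow> continuous_on S f"
  unfolding smooth_on_def using Ck_on.simps(1) by blast

lemma smooth_on_ident: "open S \<Longrightarrow> smooth_on S (\<lambda>x. x)"
  unfolding smooth_on_def
proof
  fix k assume "open S"
  show "Ck_on k S (\<lambda>x. x)"
  proof (cases k)
    case (Suc n)
    show ?thesis unfolding Suc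
      by (rule Ck_on_SucI[OF \<open>open S\<close> has_derivative_ident]) (rule Ck_on_const[OF \<open>open S\<close>])
  qed auto
qed

lemma linear_basis_expansion:
  fixes L :: "'b::euclidean_space \<Rightarrow> real"
  assumes "bounded_linear L"
  shows "L v = (\<Sum>b\<in>Basis. (v \<bullet> b) * L b)"
proof -
  have "L v = L (\<Sum>b\<in>Basis. (v \<bullet> b) *\<^sub>R b)" by (simp add: euclidean_representation)
  also have "\<dots> = (\<Sum>b\<in>Basis. (v \<bullet> b) * L b)"
    using assms by (simp add: bounded_linear.linear linear_sum linear_cmul)
  finally show ?thesis .
qed

text \<open>
  By the chain rule, the derivative of \<open>g \<circ> f\<close> in direction \<open>v\<close> is
  \<open>\<Sum>\<^sub>b (Df(x)v \<bullet> b) (D\<^sub>bg)(f x)\<close>, which involves the derivatives \<open>D\<^sub>bg\<close> along basis vectors only.  So the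
  induction on the order of differentiability has to be over all smooth \<open>g\<close>.
\<close>

lemma smooth_on_compose:
  fixes f :: "'b::real_normed_vector \<Rightarrow> 'c::euclidean_space" and g :: "'c \<Rightarrow> real"
  assumes "open S" and "smooth_on S f" and "smooth_on T g" and "f ` S \<subseteq> T"
  shows "smooth_on S (\<lambda>x. g (f x))"
proof -
  have "Ck_on k S (\<lambda>x. g (f x))" for k
    using assms(3)
  proof (induction k arbitrary: g)
    case 0
    have "continuous_on (f ` S) g"
      using continuous_on_subset[OF smooth_on_imp_continuous_on[OF 0] assms(4)] .
    then show ?case
      using smooth_on_imp_continuous_on[OF assms(2)] by (simp add: continuous_on_compose2)
  next
    case (Suc k)
    let ?Df = "\<lambda>x. frechet_derivative f (at x)" and ?Dg = "\<lambda>y. frechet_derivative g (at y)"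
    have D: "((\<lambda>x. g (f x)) has_derivative (\<lambda>v. ?Dg (f x) (?Df x v))) (at x)" if "x \<in> S" for x
    proof -
      have "f x \<in> T" using assms(4) that by auto
      then show ?thesis
        using diff_chain_at[OF smooth_on_has_derivative[OF assms(2) that]
                smooth_on_has_derivative[OF Suc.prems]] by (simp add: o_def)
    qed
    have E: "?Dg (f x) (?Df x v) = (\<Sum>b\<in>Basis. (?Df x v \<bullet> b) * ?Dg (f x) b)" if "x \<in> S" for x v
    proof (rule linear_basis_expansion)
      show "bounded_linear (?Dg (f x))"
        using smooth_on_has_derivative[OF Suc.prems] assms(4) that
        by (intro has_derivative_bounded_linear) auto
    qed
    have C: "Ck_on k S (\<lambda>x. \<Sum>b\<in>Basis. (?Df x v \<bullet> b) * ?Dg (f x) b)" for v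
    proof -
      have sm: "Ck_on k S (\<lambda>x. \<Sum>b\<in>B. h b x)"
        if "finite B" "\<And>b. b \<in> B \<Longrightarrow> Ck_on k S (h b)" for B and h :: "'c \<Rightarrow> 'b \<Rightarrow> real"
        using that by (induction B) (auto intro: Ck_on_const Ck_on_add \<open>open S\<close>)
      have "Ck_on k S (\<lambda>x. ?Df x v \<bullet> b)" for b
        using smooth_on_bounded_linear[OF \<open>open S\<close> bounded_linear_inner_left
            smooth_on_frechet_derivative[OF assms(2)]]
        by (simp add: smooth_on_def)
      then show ?thesis
        by (intro sm Ck_on_mult \<open>open S\<close> Suc.IH smooth_on_frechet_derivative Suc.prems) auto
    qed
    show ?case
      by (rule Ck_on_SucI[OF \<open>open S\<close> D], assumption)
         (rule Ck_on_cong[OF \<open>open S\<close> _ C], simp add: E)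
  qed
  then show ?thesis by (simp add: smooth_on_def)
qed

section \<open>Bump functions on Euclidean space\<close>

text \<open>
  The factor \<open>t\<^sup>-\<^sup>n\<close> makes the family closed under differentiation: each derivative is a linear
  combination of two members.  So all members are smooth at once, in particular \<open>flat_exp 0\<close>, the
  standard function that is positive on the right half-line and flat at \<open>0\<close>.
\<close>

definition flat_exp :: "nat \<Rightarrow> real \<Rightarrow> real" where
  "flat_exp n t = (if t > 0 then exp (- inverse t) * inverse t ^ n else 0)"

lemma flat_exp_tendsto_0: "(flat_exp n \<longlongrightarrow> 0) (at 0)"
proof -
  have "((\<lambda>s::real. s ^ n / exp s) \<longlongrightarrow> 0) at_top"
    by (rule tendsto_power_div_exp_0)
  from filterlim_compose[OF this filterlim_inverse_at_top_right]
  have "((\<lambda>t::real. inverse t ^ n / exp (inverse t)) \<longlongrightarrow> 0) (at_right 0)" .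
  then have "(flat_exp n \<longlongrightarrow> 0) (at_right 0)"
    by (rule Lim_transform_eventually)
       (auto simp: eventually_at_filter flat_exp_def exp_minus field_simps)
  moreover have "(flat_exp n \<longlongrightarrow> 0) (at_left 0)"
    by (rule Lim_transform_eventually[OF tendsto_const])
       (auto simp: eventually_at_filter flat_exp_def)
  ultimately show ?thesis by (intro filterlim_split_at)
qed

text \<open>
  Only \<open>t = 0\<close> is critical; there the difference quotient of \<open>flat_exp n\<close> is \<open>flat_exp (n + 1)\<close>,
  which tends to \<open>0\<close>.
\<close>

lemma flat_exp_deriv:
  "(flat_exp n has_real_derivative (flat_exp (n + 2) t - n * flat_exp (n + 1) t)) (at t)"
proof -
  consider "t > 0" | "t < 0" | "t = 0" by linarith
  then show ?thesis
  proof cases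
    case 1
    have "((\<lambda>t. exp (- inverse t) * inverse t ^ n) has_real_derivative
            (flat_exp (n + 2) t - n * flat_exp (n + 1) t)) (at t)"
    proof -
      have "((\<lambda>t. inverse t ^ n) has_real_derivative - real n * inverse t ^ (n + 1)) (at t)"
        using DERIV_power[OF DERIV_inverse[of t], of n] 1
        by (cases n) (simp_all add: algebra_simps power2_eq_square numeral_2_eq_2)
      moreover have "((\<lambda>t. exp (- inverse t)) has_real_derivative
          exp (- inverse t) * (inverse t * inverse t)) (at t)"
        using 1 by (auto intro!: derivative_eq_intros)
      ultimately show ?thesis
        using 1 by (auto dest: DERIV_mult simp: flat_exp_def algebra_simps)
    qed
    then show ?thesis
      by (rule has_field_derivative_transform_within_open[of _ _ _ "{0<..}"])
         (use 1 in \<open>auto simp: flat_exp_def\<close>)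
  next
    case 2
    have "((\<lambda>t. 0) has_real_derivative (flat_exp (n + 2) t - n * flat_exp (n + 1) t)) (at t)"
      using 2 by (auto simp: flat_exp_def)
    then show ?thesis
      by (rule has_field_derivative_transform_within_open[of _ _ _ "{..<0}"])
         (use 2 in \<open>auto simp: flat_exp_def\<close>)
  next
    case 3
    \<comment> \<open>at 0 both sides are 0, as division by zero gives 0\<close>
    have "(\<lambda>h. flat_exp n h / h) = flat_exp (n + 1)"
      by (auto simp: flat_exp_def fun_eq_iff field_simps)
    then show ?thesis
      using 3 flat_exp_tendsto_0[of "n + 1"] by (simp add: DERIV_def flat_exp_def[of _ 0])
  qed
qed

lemma smooth_flat_exp: "smooth_on UNIV (flat_exp n)"
proof -
  have "Ck_on k UNIV (flat_exp n)" for k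
  proof (induction k arbitrary: n)
    case 0
    show ?case
      using DERIV_isCont[OF flat_exp_deriv] by (simp add: continuous_at_imp_continuous_on)
  next
    case (Suc k)
    show ?case
    proof (rule Ck_on_SucI)
      show "(flat_exp n has_derivative (\<lambda>v. (flat_exp (n + 2) t + (- n) * flat_exp (n + 1) t) * v)) (at t)"
        for t using flat_exp_deriv[of n t] by (simp add: has_field_derivative_def)
    qed (intro open_UNIV Ck_on_mult Ck_on_add Ck_on_const Suc.IH)+
  qed
  then show ?thesis by (simp add: smooth_on_def)
qed

text \<open>
  The quotient \<open>u / (u + v)\<close>, where the smooth function \<open>u \<ge> 0\<close> is positive exactly on the ball of
  radius \<open>r\<close> and \<open>v \<ge> 0\<close> exactly off the closed ball of radius \<open>r / 2\<close>.
\<close>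

lemma euclidean_bump:
  fixes y0 :: "'b::euclidean_space"
  assumes "r > 0"
  obtains \<beta> :: "'b \<Rightarrow> real" where "smooth_on UNIV \<beta>" "\<And>y. 0 \<le> \<beta> y \<and> \<beta> y \<le> 1"
    "\<And>y. dist y0 y < r / 2 \<Longrightarrow> \<beta> y = 1" "\<And>y. dist y0 y \<ge> r \<Longrightarrow> \<beta> y = 0"
proof -
  let ?n = "\<lambda>y. (\<Sum>b\<in>Basis. ((y - y0) \<bullet> b) * ((y - y0) \<bullet> b))"
  define u where "u y = flat_exp 0 (r\<^sup>2 + (-1) * ?n y)" for y
  define v where "v y = flat_exp 0 (?n y + (- (r/2)\<^sup>2))" for y
  have n: "?n y = (dist y0 y)\<^sup>2" for y
    by (metis (no_types, lifting) dist_commute dist_norm euclidean_inner power2_norm_eq_inner sum.cong)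
  have lin: "smooth_on UNIV (\<lambda>y. (y - y0) \<bullet> b)" for b :: 'b
    using smooth_on_diff[OF open_UNIV
        smooth_on_bounded_linear[OF open_UNIV bounded_linear_inner_left smooth_on_ident[OF open_UNIV]]
        smooth_on_const[OF open_UNIV], of b "y0 \<bullet> b"]
    by (simp add: inner_diff_left)
  have "smooth_on UNIV ?n"
    by (intro smooth_on_sum smooth_on_mult open_UNIV lin)
  then have su: "smooth_on UNIV u" and sv: "smooth_on UNIV v"
    unfolding u_def v_def
    by (auto intro!: smooth_on_compose[OF open_UNIV _ smooth_flat_exp]
        smooth_on_diff smooth_on_add smooth_on_mult smooth_on_const)
  have nonneg: "u y \<ge> 0" "v y \<ge> 0" for y by (auto simp: u_def v_def flat_exp_def)
  have "u y > 0 \<or> v y > 0" for y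
  proof (cases "dist y0 y < r")
    case True
    then have "(dist y0 y)\<^sup>2 < r\<^sup>2" by (simp add: power_strict_mono)
    then show ?thesis by (simp add: u_def n flat_exp_def)
  next
    case False
    then have "(r/2)\<^sup>2 < (dist y0 y)\<^sup>2" using assms by (intro power_strict_mono) auto
    then show ?thesis by (simp add: v_def n flat_exp_def)
  qed
  then have pos: "u y + v y > 0" for y using nonneg[of y] by (metis add_nonneg_pos add_pos_nonneg)
  show thesis
  proof (rule that[of "\<lambda>y. u y * inverse (u y + v y)"])
    have "u y + v y \<noteq> 0" for y using pos[of y] by simp
    then show "smooth_on UNIV (\<lambda>y. u y * inverse (u y + v y))"
      using su sv by (intro smooth_on_mult smooth_on_inverse smooth_on_add) auto
    show "0 \<le> u y * inverse (u y + v y) \<and> u y * inverse (u y + v y) \<le> 1" for y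
      using nonneg[of y] pos[of y] by (auto simp: field_simps)
    show "u y * inverse (u y + v y) = 1" if "dist y0 y < r / 2" for y
    proof -
      have "(dist y0 y)\<^sup>2 \<le> (r/2)\<^sup>2" using that by (intro power_mono) auto
      then have "v y = 0" unfolding v_def n flat_exp_def by simp
      then show ?thesis using pos[of y] by simp
    qed
    show "u y * inverse (u y + v y) = 0" if "dist y0 y \<ge> r" for y
    proof -
      have "r\<^sup>2 \<le> (dist y0 y)\<^sup>2" using that assms by (intro power_mono) auto
      then have "u y = 0" unfolding u_def n flat_exp_def by simp
      then show ?thesis by simp
    qed
  qed
qed

section \<open>Hadamard's lemma\<close>

text \<open>
  Differentiation under the integral sign turns \<open>\<integral> t\<^sup>m h(c + t(y - c)) dt\<close> into integrals of the same
  shape, with \<open>m + 1\<close> and a directional derivative of \<open>h\<close>.  The weight \<open>t\<^sup>m\<close> is there to close the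
  induction.
\<close>

lemma smooth_ray_integral:
  fixes h :: "'b::euclidean_space \<Rightarrow> real"
  assumes "smooth_on (ball c r) h"
  shows "smooth_on (ball c r) (\<lambda>y. integral {0..1} (\<lambda>t. t ^ m * h (c + t *\<^sub>R (y - c))))"
proof -
  let ?S = "ball c r"
  have ray: "c + t *\<^sub>R (y - c) \<in> ?S" if "y \<in> ?S" "t \<in> {0..1}" for y t
  proof -
    have "\<bar>t\<bar> * norm (y - c) \<le> 1 * norm (y - c)" using that by (intro mult_right_mono) auto
    then show ?thesis using that by (simp add: dist_norm norm_minus_commute)
  qed
  have cont: "continuous_on (?S \<times> {0..1}) (\<lambda>(y, t). t ^ m * g (c + t *\<^sub>R (y - c)))"
    if "smooth_on ?S g" for g :: "'b \<Rightarrow> real" and m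
  proof -
    have "continuous_on (?S \<times> {0..1}) (\<lambda>z. g (c + snd z *\<^sub>R (fst z - c)))"
      by (rule continuous_on_compose2[OF smooth_on_imp_continuous_on[OF that]])
         (use ray in \<open>auto intro!: continuous_intros\<close>)
    then show ?thesis by (auto intro!: continuous_intros simp: case_prod_beta)
  qed
  have slice: "continuous_on {0..1} (\<lambda>t. t ^ m * g (c + t *\<^sub>R (y - c)))"
    if "smooth_on ?S g" "y \<in> ?S" for g :: "'b \<Rightarrow> real" and m y
  proof -
    have "continuous_on {0..1} (Pair y)" by (intro continuous_intros)
    moreover have "Pair y ` {0..1} \<subseteq> ?S \<times> {0..1}" using that(2) by auto
    ultimately have "continuous_on {0..1} (\<lambda>t. case Pair y t of (y, t) \<Rightarrow> t ^ m * g (c + t *\<^sub>R (y - c)))"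
      by (rule continuous_on_compose2[OF cont[OF that(1), of m]])
    then show ?thesis by simp
  qed
  have D: "((\<lambda>y. integral {0..1} (\<lambda>t. t ^ m * h (c + t *\<^sub>R (y - c)))) has_derivative
      (\<lambda>v. \<Sum>b\<in>Basis. (v \<bullet> b) * integral {0..1}
          (\<lambda>t. t ^ Suc m * frechet_derivative h (at (c + t *\<^sub>R (y - c))) b))) (at y)"
    if h: "smooth_on ?S h" and y: "y \<in> ?S" for h :: "'b \<Rightarrow> real" and m y
  proof -
    let ?d = "\<lambda>y t b. t ^ Suc m * frechet_derivative h (at (c + t *\<^sub>R (y - c))) b"
    define fx :: "'b \<Rightarrow> real \<Rightarrow> 'b \<Rightarrow>\<^sub>L real"
      where "fx y t = (\<Sum>b\<in>Basis. ?d y t b *\<^sub>R blinfun_inner_left b)" for y t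
    have "((\<lambda>y. integral (cbox 0 1) (\<lambda>t. t ^ m * h (c + t *\<^sub>R (y - c)))) has_derivative
        integral (cbox 0 1) (fx y)) (at y within ?S)"
    proof (rule leibniz_rule[OF _ _ _ y])
      fix x t assume x: "x \<in> ?S" and "t \<in> cbox (0::real) 1"
      then have t: "t \<in> {0..1}" by simp
      let ?H = "frechet_derivative h (at (c + t *\<^sub>R (x - c)))"
      have hd: "(h has_derivative ?H) (at (c + t *\<^sub>R (x - c)))"
        by (rule smooth_on_has_derivative[OF h ray[OF x t]])
      have "((\<lambda>y. c + t *\<^sub>R (y - c)) has_derivative (\<lambda>v. t *\<^sub>R v)) (at x)"
        by (auto intro!: derivative_eq_intros simp: algebra_simps)
      from diff_chain_at[OF this hd]
      have "((\<lambda>y. t ^ m * h (c + t *\<^sub>R (y - c))) has_derivative (\<lambda>v. t ^ m * ?H (t *\<^sub>R v))) (at x)"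
        by (auto intro!: derivative_eq_intros simp: o_def)
      moreover have "t ^ m * ?H (t *\<^sub>R v) = fx x t v" for v
        using linear_basis_expansion[OF has_derivative_bounded_linear[OF hd], of "t *\<^sub>R v"]
        by (simp add: fx_def blinfun.sum_left blinfun.scaleR_left sum_distrib_left inner_commute
            mult_ac)
      ultimately show "((\<lambda>y. t ^ m * h (c + t *\<^sub>R (y - c))) has_derivative fx x t) (at x within ?S)"
        by (simp add: has_derivative_at_withinI)
    next
      fix x assume "x \<in> ?S"
      then show "(\<lambda>t. t ^ m * h (c + t *\<^sub>R (x - c))) integrable_on cbox 0 1"
        using integrable_continuous_interval[OF slice[OF h]] by simp
    next
      show "continuous_on (?S \<times> cbox 0 1) (\<lambda>(x, t). fx x t)"
        using cont[OF smooth_on_frechet_derivative[OF h], where m = "Suc m"]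
        by (auto simp: fx_def case_prod_beta intro!: continuous_on_sum continuous_on_scaleR)
    qed auto
    moreover have "blinfun_apply (integral (cbox 0 1) (fx y))
        = (\<lambda>v. \<Sum>b\<in>Basis. (v \<bullet> b) * integral {0..1} (\<lambda>t. ?d y t b))"
    proof
      fix v
      have int: "(\<lambda>t. ?d y t b) integrable_on {0..1}" for b
        by (rule integrable_continuous_interval[OF slice[OF smooth_on_frechet_derivative[OF h] y]])
      have "integral {0..1} (fx y) = (\<Sum>b\<in>Basis. integral {0..1} (\<lambda>t. ?d y t b) *\<^sub>R blinfun_inner_left b)"
        unfolding fx_def using int
        by (subst integral_sum) (auto intro!: integrable_on_scaleR_left sum.cong
            integral_unique[OF has_integral_scaleR_left[OF integrable_integral]])
      then show "integral (cbox 0 1) (fx y) v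
          = (\<Sum>b\<in>Basis. (v \<bullet> b) * integral {0..1} (\<lambda>t. ?d y t b))"
        by (simp add: blinfun.sum_left blinfun.scaleR_left inner_commute mult_ac)
    qed
    ultimately show ?thesis
      by (simp add: at_within_open[OF y])
  qed
  have "Ck_on k ?S (\<lambda>y. integral {0..1} (\<lambda>t. t ^ m * h (c + t *\<^sub>R (y - c))))" for k
    using assms
  proof (induction k arbitrary: h m)
    case 0
    show ?case
      using has_derivative_continuous[OF D[OF 0]] by (auto intro!: continuous_at_imp_continuous_on)
  next
    case (Suc k)
    have sm: "Ck_on k ?S (\<lambda>x. \<Sum>b\<in>B. h b x)"
      if "finite B" "\<And>b. b \<in> B \<Longrightarrow> Ck_on k ?S (h b)" for B and h :: "'b \<Rightarrow> 'b \<Rightarrow> real"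
      using that by (induction B) (auto intro: Ck_on_const Ck_on_add)
    show ?case
    proof (rule Ck_on_SucI[OF open_ball D[OF Suc.prems]])
      fix v
      show "Ck_on k ?S (\<lambda>y. \<Sum>b\<in>Basis. (v \<bullet> b) * integral {0..1}
          (\<lambda>t. t ^ Suc m * frechet_derivative h (at (c + t *\<^sub>R (y - c))) b))"
        by (intro sm Ck_on_mult Ck_on_const open_ball finite_Basis Suc.IH
            smooth_on_frechet_derivative Suc.prems)
    qed
  qed
  then show ?thesis by (simp add: smooth_on_def)
qed

text \<open>
  \<open>g\<^sub>b(y)\<close> is the mean of the partial derivative \<open>\<partial>\<^sub>b f\<close> over the segment from \<open>c\<close> to \<open>y\<close>, and the
  formula is the fundamental theorem of calculus along that segment.
\<close>

lemma Hadamard: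
  fixes f :: "'b::euclidean_space \<Rightarrow> real"
  assumes f: "smooth_on (ball c r) f"
  obtains g where "\<And>b. smooth_on (ball c r) (g b)"
    "\<And>y. y \<in> ball c r \<Longrightarrow> f y = f c + (\<Sum>b\<in>Basis. ((y - c) \<bullet> b) * g b y)"
    "\<And>b. g b c = frechet_derivative f (at c) b"
proof (rule that)
  let ?D = "\<lambda>b y. frechet_derivative f (at y) b"
  let ?g = "\<lambda>b y. integral {0..1} (\<lambda>t. t ^ 0 * ?D b (c + t *\<^sub>R (y - c)))"
  show "smooth_on (ball c r) (?g b)" for b
    by (rule smooth_ray_integral[OF smooth_on_frechet_derivative[OF f]])
  show "?g b c = ?D b c" for b by simp
  fix y assume y: "y \<in> ball c r"
  have ray: "c + t *\<^sub>R (y - c) \<in> ball c r" if "t \<in> {0..1}" for t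
  proof -
    have "\<bar>t\<bar> * norm (y - c) \<le> 1 * norm (y - c)" using that by (intro mult_right_mono) auto
    then show ?thesis using y by (simp add: dist_norm norm_minus_commute)
  qed
  note hd = smooth_on_has_derivative[OF f ray]
  have "((\<lambda>t. f (c + t *\<^sub>R (y - c))) has_vector_derivative ?D (y - c) (c + t *\<^sub>R (y - c)))
          (at t within {0..1})" if "t \<in> {0..1}" for t
  proof -
    have "((\<lambda>t. c + t *\<^sub>R (y - c)) has_derivative (\<lambda>s. s *\<^sub>R (y - c))) (at t)"
      by (auto intro!: derivative_eq_intros)
    from diff_chain_at[OF this hd[OF that]] show ?thesis
      using linear_cmul[OF has_derivative_linear[OF hd[OF that]]]
      by (simp add: has_vector_derivative_def o_def has_derivative_at_withinI)
  qed
  from fundamental_theorem_of_calculus[OF _ this]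
  have F: "((\<lambda>t. ?D (y - c) (c + t *\<^sub>R (y - c))) has_integral f y - f c) {0..1}" by simp
  have int: "(\<lambda>t. ?D b (c + t *\<^sub>R (y - c))) integrable_on {0..1}" for b
  proof (rule integrable_continuous_interval)
    show "continuous_on {0..1} (\<lambda>t. ?D b (c + t *\<^sub>R (y - c)))"
      by (rule continuous_on_compose2[OF smooth_on_imp_continuous_on[OF
              smooth_on_frechet_derivative[OF f, of b]]])
         (use ray in \<open>auto intro!: continuous_intros\<close>)
  qed
  have "f y - f c = integral {0..1} (\<lambda>t. ?D (y - c) (c + t *\<^sub>R (y - c)))"
    using F by (simp add: integral_unique)
  also have "\<dots> = integral {0..1} (\<lambda>t. \<Sum>b\<in>Basis. ((y - c) \<bullet> b) * ?D b (c + t *\<^sub>R (y - c)))"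
    by (rule integral_cong) (rule linear_basis_expansion[OF has_derivative_bounded_linear[OF hd]])
  also have "\<dots> = (\<Sum>b\<in>Basis. ((y - c) \<bullet> b) * ?g b y)"
    by (subst integral_sum) (auto intro!: int integrable_on_mult_right)
  finally show "f y = f c + (\<Sum>b\<in>Basis. ((y - c) \<bullet> b) * ?g b y)" by simp
qed

section \<open>Smooth functions on a manifold\<close>

locale smooth_manifold =
  fixes A :: "('a::{t2_space, second_countable_topology}, 'b::euclidean_space) atlas"
  assumes atlas: "smooth_atlas A"
begin

abbreviation "\<F> \<equiv> smooth_functions A"
abbreviation "\<T> \<equiv> tangent_space A"
abbreviation "\<X> \<equiv> vector_fields A"

lemma chart:
  assumes "(U, \<phi>) \<in> A"
  shows "open U" "open (\<phi> ` U)" "homeomorphism U (\<phi> ` U) \<phi> (inv_into U \<phi>)"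
  using atlas assms by (auto simp: smooth_atlas_def)

lemma chart_at: obtains U \<phi> where "(U, \<phi>) \<in> A" "p \<in> U"
proof -
  have "p \<in> (\<Union>(U, \<phi>)\<in>A. U)" using atlas by (simp add: smooth_atlas_def)
  then show thesis using that by auto
qed

lemma chart_transition:
  "(U, \<phi>) \<in> A \<Longrightarrow> (V, \<psi>) \<in> A \<Longrightarrow> smooth_on (\<phi> ` (U \<inter> V)) (\<psi> \<circ> inv_into U \<phi>)"
  using atlas by (fastforce simp: smooth_atlas_def)

lemma chart_inv [simp]: "(U, \<phi>) \<in> A \<Longrightarrow> q \<in> U \<Longrightarrow> inv_into U \<phi> (\<phi> q) = q"
  using chart(3) by (metis homeomorphism_def)

lemma chart_open_image:
  assumes "(U, \<phi>) \<in> A" "open V" "V \<subseteq> U"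
  shows "open (\<phi> ` V)"
proof -
  have "openin (top_of_set U) V" using assms by (simp add: open_subset)
  from homeomorphism_imp_open_map[OF chart(3)[OF assms(1)] this]
  show ?thesis using chart(2)[OF assms(1)] openin_open_trans by blast
qed

lemma smooth_functions_chart:
  "f \<in> \<F> \<Longrightarrow> (U, \<phi>) \<in> A \<Longrightarrow> smooth_on (\<phi> ` U) (\<lambda>y. f (inv_into U \<phi> y))"
  by (auto simp: smooth_functions_def o_def)

lemma smooth_functionsI:
  "(\<And>U \<phi>. (U, \<phi>) \<in> A \<Longrightarrow> smooth_on (\<phi> ` U) (\<lambda>y. f (inv_into U \<phi> y))) \<Longrightarrow> f \<in> \<F>"
  by (auto simp: smooth_functions_def o_def)

lemma fun_const [intro]: "(\<lambda>q. c) \<in> \<F>"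
  by (rule smooth_functionsI) (simp add: smooth_on_const chart(2))

lemma fun_add [intro]: "f \<in> \<F> \<Longrightarrow> g \<in> \<F> \<Longrightarrow> (\<lambda>q. f q + g q) \<in> \<F>"
  by (rule smooth_functionsI) (intro smooth_on_add smooth_functions_chart chart(2))

lemma fun_mult [intro]: "f \<in> \<F> \<Longrightarrow> g \<in> \<F> \<Longrightarrow> (\<lambda>q. f q * g q) \<in> \<F>"
  by (rule smooth_functionsI) (intro smooth_on_mult smooth_functions_chart chart(2))

lemma fun_diff [intro]: "f \<in> \<F> \<Longrightarrow> g \<in> \<F> \<Longrightarrow> (\<lambda>q. f q - g q) \<in> \<F>"
  by (rule smooth_functionsI) (intro smooth_on_diff smooth_functions_chart chart(2))

lemma fun_inverse:
  "f \<in> \<F> \<Longrightarrow> (\<And>q. f q \<noteq> 0) \<Longrightarrow> (\<lambda>q. inverse (f q)) \<in> \<F>"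
  by (rule smooth_functionsI) (intro smooth_on_inverse smooth_functions_chart chart(2))

lemma fun_sum [intro]: "(\<And>i. i \<in> I \<Longrightarrow> f i \<in> \<F>) \<Longrightarrow> (\<lambda>q. \<Sum>i\<in>I. f i q) \<in> \<F>"
  by (induction I rule: infinite_finite_induct) auto

lemma fun_prod [intro]: "(\<And>i. i \<in> I \<Longrightarrow> f i \<in> \<F>) \<Longrightarrow> (\<lambda>q. \<Prod>i\<in>I. f i q) \<in> \<F>"
  by (induction I rule: infinite_finite_induct) auto

text \<open>
  Smoothness is a local property: a function that agrees near every point with some global
  smooth function is itself smooth.  This allows most arguments below to avoid charts.
\<close>

lemma smooth_functions_local:
  assumes "\<And>p. \<exists>V g. open V \<and> p \<in> V \<and> g \<in> \<F> \<and> (\<forall>q\<in>V. f q = g q)"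
  shows "f \<in> \<F>"
proof (rule smooth_functionsI)
  fix U \<phi> assume c: "(U, \<phi>) \<in> A"
  show "smooth_on (\<phi> ` U) (\<lambda>y. f (inv_into U \<phi> y))"
  proof (rule smooth_on_local)
    fix y assume "y \<in> \<phi> ` U"
    then obtain p where p: "p \<in> U" "y = \<phi> p" by auto
    obtain V g where V: "open V" "p \<in> V" "g \<in> \<F>" "\<forall>q\<in>V. f q = g q" using assms by metis
    have o: "open (\<phi> ` (U \<inter> V))" using chart_open_image[OF c] chart(1)[OF c] V(1) by auto
    have "smooth_on (\<phi> ` (U \<inter> V)) (\<lambda>y. f (inv_into U \<phi> y))"
      by (rule smooth_on_cong[OF o _ smooth_on_subset[OF smooth_functions_chart[OF V(3) c]]])
         (use V(4) c in auto)
    then show "\<exists>T. open T \<and> y \<in> T \<and> smooth_on T (\<lambda>y. f (inv_into U \<phi> y))"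
      using o p V(2) by blast
  qed
qed

text \<open>
  A function supported in a closed subset of a chart domain is smooth as soon as it is so in
  that chart: near a point of \<open>V\<close> one changes coordinates, near any other point it vanishes.
\<close>

lemma smooth_chart_extension:
  assumes c: "(U, \<phi>) \<in> A" and V: "open V" "V \<subseteq> U" and K: "closed K" "K \<subseteq> V"
    and zero: "\<And>q. q \<notin> K \<Longrightarrow> h q = 0"
    and sm: "smooth_on (\<phi> ` V) (\<lambda>y. h (inv_into U \<phi> y))"
  shows "h \<in> \<F>"
proof (rule smooth_functionsI)
  fix U' \<psi> assume c': "(U', \<psi>) \<in> A"
  show "smooth_on (\<psi> ` U') (\<lambda>z. h (inv_into U' \<psi> z))"
  proof (rule smooth_on_local)
    fix z assume "z \<in> \<psi> ` U'"
    then obtain q where q: "q \<in> U'" "z = \<psi> q" by auto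
    show "\<exists>T. open T \<and> z \<in> T \<and> smooth_on T (\<lambda>z. h (inv_into U' \<psi> z))"
    proof (cases "q \<in> V")
      case True
      let ?T = "\<psi> ` (U' \<inter> V)"
      have o: "open ?T" using chart_open_image[OF c'] chart(1)[OF c'] V(1) by auto
      have "smooth_on ?T (\<phi> \<circ> inv_into U' \<psi>)"
        by (rule smooth_on_subset[OF chart_transition[OF c' c]]) (use V(2) in auto)
      moreover have "(\<phi> \<circ> inv_into U' \<psi>) ` ?T \<subseteq> \<phi> ` V" using c' by auto
      ultimately have "smooth_on ?T (\<lambda>z. h (inv_into U \<phi> ((\<phi> \<circ> inv_into U' \<psi>) z)))"
        by (rule smooth_on_compose[OF o _ sm])
      then have "smooth_on ?T (\<lambda>z. h (inv_into U' \<psi> z))"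
        by (rule smooth_on_cong[OF o, rotated]) (use c c' V(2) in auto)
      then show ?thesis using o q True by blast
    next
      case False
      let ?T = "\<psi> ` (U' - K)"
      have o: "open ?T" using chart_open_image[OF c'] chart(1)[OF c'] K(1) by auto
      have "smooth_on ?T (\<lambda>z. h (inv_into U' \<psi> z))"
        by (rule smooth_on_cong[OF o _ smooth_on_const[OF o, of 0]]) (use c' zero in auto)
      then show ?thesis using o q False K(2) by blast
    qed
  qed
qed

text \<open>
  The support \<open>K\<close> is the inverse image of a compact ball in a chart; it is closed in the manifold
  because compact sets in a Hausdorff space are closed.
\<close>

lemma bump:
  assumes "open V" "p \<in> V"
  obtains \<rho> K W where "\<rho> \<in> \<F>" "\<And>q. 0 \<le> \<rho> q \<and> \<rho> q \<le> 1" "closed K" "K \<subseteq> V"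
    "\<And>q. q \<notin> K \<Longrightarrow> \<rho> q = 0" "open W" "p \<in> W" "W \<subseteq> V" "\<And>q. q \<in> W \<Longrightarrow> \<rho> q = 1"
proof -
  obtain U \<phi> where c: "(U, \<phi>) \<in> A" and p: "p \<in> U" by (rule chart_at)
  have UV: "open (U \<inter> V)" "U \<inter> V \<subseteq> U" using chart(1)[OF c] assms(1) by auto
  have "open (\<phi> ` (U \<inter> V))" by (rule chart_open_image[OF c UV])
  then obtain r where r: "r > 0" "cball (\<phi> p) r \<subseteq> \<phi> ` (U \<inter> V)"
    using p assms(2) open_contains_cball by (metis IntI imageI)
  obtain \<beta> :: "'b \<Rightarrow> real" where
    \<beta>: "smooth_on UNIV \<beta>" "\<And>y. 0 \<le> \<beta> y \<and> \<beta> y \<le> 1"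
    "\<And>y. dist (\<phi> p) y < r / 2 \<Longrightarrow> \<beta> y = 1" "\<And>y. dist (\<phi> p) y \<ge> r \<Longrightarrow> \<beta> y = 0"
    using euclidean_bump[OF r(1), of "\<phi> p"] by blast
  let ?i = "inv_into U \<phi>"
  define K where "K = ?i ` cball (\<phi> p) r"
  define W where "W = U \<inter> V \<inter> \<phi> -` ball (\<phi> p) (r / 2)"
  define \<rho> where "\<rho> q = (if q \<in> U \<inter> V then \<beta> (\<phi> q) else 0)" for q
  have "continuous_on (cball (\<phi> p) r) ?i"
    using chart(3)[OF c] r(2) by (auto simp: homeomorphism_def intro: continuous_on_subset)
  then have K: "closed K" unfolding K_def
    by (intro compact_imp_closed compact_continuous_image) auto
  have KV: "K \<subseteq> U \<inter> V" using r(2) c by (force simp: K_def)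
  \<comment> \<open>\<open>\<beta>\<close> vanishes off the ball of radius \<open>r\<close>, and \<open>K\<close> corresponds to that ball\<close>
  have zero: "\<rho> q = 0" if "q \<notin> K" for q
  proof (cases "q \<in> U \<inter> V")
    case True
    have "\<phi> q \<notin> cball (\<phi> p) r"
    proof
      assume "\<phi> q \<in> cball (\<phi> p) r"
      then have "?i (\<phi> q) \<in> K" by (auto simp: K_def)
      then show False using True that c by auto
    qed
    then show ?thesis by (simp add: \<rho>_def \<beta>(4))
  qed (simp add: \<rho>_def del: Int_iff)
  have oi: "open (\<phi> ` (U \<inter> V))" by (rule chart_open_image[OF c UV])
  have "smooth_on (\<phi> ` (U \<inter> V)) (\<lambda>y. \<rho> (?i y))"
    by (rule smooth_on_cong[OF oi _ smooth_on_subset[OF \<beta>(1)]]) (use c in \<open>auto simp: \<rho>_def\<close>)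
  then have \<rho>: "\<rho> \<in> \<F>" by (rule smooth_chart_extension[OF c UV K KV, rotated]) (rule zero)
  have W: "open W"
  proof -
    have "continuous_on (U \<inter> V) \<phi>"
      using chart(3)[OF c] by (auto simp: homeomorphism_def intro: continuous_on_subset)
    then show ?thesis unfolding W_def
      using UV(1) by (auto simp: continuous_on_open_vimage Int_commute)
  qed
  show thesis
    by (rule that[of \<rho> K W])
       (use \<rho> K KV zero W p assms(2) r(1) \<beta>(2,3) in \<open>auto simp: \<rho>_def W_def\<close>)
qed

text \<open>
  The reciprocal of \<open>g\<close> exists only near \<open>p\<close>, but a smooth function on the whole manifold is wanted.
  So \<open>g\<close> is first blended with the constant \<open>g p\<close> by a bump function supported where \<open>g\<close> has the
  sign of \<open>g p\<close>; the result vanishes nowhere.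
\<close>

lemma local_reciprocal:
  assumes g: "g \<in> \<F>" and "g p \<noteq> 0"
  obtains h W where "h \<in> \<F>" "open W" "p \<in> W" "\<And>q. q \<in> W \<Longrightarrow> g q * h q = 1"
proof -
  have "\<exists>V. open V \<and> p \<in> V \<and> (\<forall>q\<in>V. g q / g p > 0)"
  proof -
    obtain U \<phi> where c: "(U, \<phi>) \<in> A" and p: "p \<in> U" by (rule chart_at)
    have "continuous_on U (\<lambda>q. g (inv_into U \<phi> (\<phi> q)))"
      using chart(3)[OF c]
      by (intro continuous_on_compose2[OF smooth_on_imp_continuous_on[OF smooth_functions_chart[OF g c]]])
         (auto simp: homeomorphism_def)
    then have "continuous_on U (\<lambda>q. g q / g p)"
      using assms(2) c by (auto intro!: continuous_intros cong: continuous_on_cong)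
    then have "open ((\<lambda>q. g q / g p) -` {0<..} \<inter> U)"
      using chart(1)[OF c] by (simp add: continuous_on_open_vimage)
    then show ?thesis using p assms(2)
      by (intro exI[of _ "(\<lambda>q. g q / g p) -` {0<..} \<inter> U"]) auto
  qed
  then obtain V where V: "open V" "p \<in> V" "\<And>q. q \<in> V \<Longrightarrow> g q / g p > 0" by auto
  from bump[OF V(1,2)] obtain \<rho> K W where \<rho>: "\<rho> \<in> \<F>" "\<And>q. 0 \<le> \<rho> q \<and> \<rho> q \<le> 1"
    "K \<subseteq> V" "\<And>q. q \<notin> K \<Longrightarrow> \<rho> q = 0" "open W" "p \<in> W" "W \<subseteq> V" "\<And>q. q \<in> W \<Longrightarrow> \<rho> q = 1"
    by metis
  \<comment> \<open>equals \<open>g\<close> on \<open>W\<close>, \<open>g p\<close> off \<open>V\<close>, and a convex combination of the two on \<open>V\<close>\<close>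
  define k where "k q = \<rho> q * g q + (1 - \<rho> q) * g p" for q
  have k: "k \<in> \<F>" unfolding k_def using \<rho>(1) g by (intro fun_add fun_mult fun_diff fun_const)
  have nz: "k q \<noteq> 0" for q
  proof -
    have eq: "k q / g p = \<rho> q * (g q / g p) + (1 - \<rho> q)" using assms(2) by (simp add: k_def field_simps)
    have "k q / g p > 0"
    proof (cases "q \<in> V")
      case True
      have "\<rho> q * (g q / g p) \<ge> 0" using V(3)[OF True] \<rho>(2)[of q] by (intro mult_nonneg_nonneg) auto
      moreover have "\<rho> q * (g q / g p) > 0 \<or> \<rho> q = 0"
        using V(3)[OF True] \<rho>(2)[of q] by (metis less_eq_real_def mult_pos_pos)
      ultimately show ?thesis using \<rho>(2)[of q] unfolding eq by auto
    next
      case False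
      then have "\<rho> q = 0" using \<rho>(3,4) by blast
      then show ?thesis unfolding eq by simp
    qed
    then show ?thesis by auto
  qed
  have "g q * inverse (k q) = 1" if "q \<in> W" for q
    using nz[of q] \<rho>(8)[OF that] by (simp add: k_def)
  then show thesis
    using fun_inverse[OF k nz] \<rho>(5,6) by (intro that[of "\<lambda>q. inverse (k q)" W])
qed

text \<open>
  Paracompactness is avoided: for bump functions \<open>\<rho>\<^sub>n\<close> that equal \<open>1\<close> on open sets \<open>V\<^sub>n\<close> covering the
  manifold (countably many suffice, by Lindeloef) put \<open>\<theta>\<^sub>n = \<rho>\<^sub>n \<Prod>\<^sub>k\<^sub><\<^sub>n (1 - \<rho>\<^sub>k)\<close>.  The partial sums telescope to
  \<open>1 - \<Prod> (1 - \<rho>\<^sub>k)\<close>, and on \<open>V\<^sub>j\<close> all later \<open>\<theta>\<^sub>n\<close> vanish, so the family is automatically locally finite.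
\<close>

lemma partition_of_unity:
  assumes W: "\<And>p. open (W p)" "\<And>p. p \<in> W p"
  obtains \<theta> :: "nat \<Rightarrow> 'a \<Rightarrow> real" and c :: "nat \<Rightarrow> 'a"
    where "\<And>n. \<theta> n \<in> \<F>" "\<And>n q. q \<notin> W (c n) \<Longrightarrow> \<theta> n q = 0"
      "\<And>p. \<exists>V m. open V \<and> p \<in> V \<and> (\<forall>q\<in>V. (\<forall>n\<ge>m. \<theta> n q = 0) \<and> (\<Sum>n<m. \<theta> n q) = 1)"
proof -
  have "\<exists>\<rho> V. \<rho> \<in> \<F> \<and> (\<forall>q. q \<notin> W p \<longrightarrow> \<rho> q = 0) \<and> open V \<and> p \<in> V \<and> (\<forall>q\<in>V. \<rho> q = 1)" for p
  proof -
    from bump[OF W(1)[of p] W(2)[of p]] obtain \<rho> K V where "\<rho> \<in> \<F>" "K \<subseteq> W p"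
      "\<And>q. q \<notin> K \<Longrightarrow> \<rho> q = 0" "open V" "p \<in> V" "\<And>q. q \<in> V \<Longrightarrow> \<rho> q = (1::real)" by metis
    then show ?thesis by (intro exI[of _ \<rho>] exI[of _ V]) auto
  qed
  then obtain \<rho> V where \<rho>: "\<And>p. \<rho> p \<in> \<F>" "\<And>p q. q \<notin> W p \<Longrightarrow> \<rho> p q = 0"
    and V: "\<And>p. open (V p)" "\<And>p. p \<in> V p" "\<And>p q. q \<in> V p \<Longrightarrow> \<rho> p q = 1" by metis
  obtain B where B: "B \<subseteq> range V" "countable B" "\<Union>B = \<Union>(range V)"
    using Lindelof[of "range V"] V(1) by auto
  then obtain P where P: "countable P" "B = V ` P" by (meson countable_subset_image)
  have cover: "(\<Union>p\<in>P. V p) = UNIV" using B(3) P(2) V(2) by auto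
  then have "P \<noteq> {}" by auto
  define c where "c = from_nat_into P"
  have c: "range c = P" unfolding c_def using P(1) \<open>P \<noteq> {}\<close> by (rule range_from_nat_into[rotated])
  define \<theta> where "\<theta> n q = \<rho> (c n) q * (\<Prod>k<n. 1 - \<rho> (c k) q)" for n q
  have part: "(\<Sum>n<m. \<theta> n q) = 1 - (\<Prod>k<m. 1 - \<rho> (c k) q)" for m q
    by (induction m) (auto simp: \<theta>_def algebra_simps)
  show thesis
  proof (rule that[of \<theta> c])
    show "\<theta> n \<in> \<F>" for n
      unfolding \<theta>_def by (intro fun_mult fun_prod fun_diff fun_const \<rho>)
    show "\<theta> n q = 0" if "q \<notin> W (c n)" for n q by (simp add: \<theta>_def \<rho>(2)[OF that])
    fix p
    have "p \<in> (\<Union>p\<in>P. V p)" unfolding cover by simp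
    then obtain j where j: "p \<in> V (c j)" using c by (metis UN_E imageE)
    have van: "(\<Prod>k<n. 1 - \<rho> (c k) q) = 0" if "q \<in> V (c j)" "n \<ge> Suc j" for q n
      using V(3)[OF that(1)] that(2) by (intro prod_zero) (auto intro!: bexI[of _ j])
    show "\<exists>V m. open V \<and> p \<in> V \<and> (\<forall>q\<in>V. (\<forall>n\<ge>m. \<theta> n q = 0) \<and> (\<Sum>n<m. \<theta> n q) = 1)"
    proof (intro exI conjI ballI allI impI)
      show "open (V (c j))" "p \<in> V (c j)" using V(1) j by auto
      fix q assume q: "q \<in> V (c j)"
      show "(\<Sum>n<Suc j. \<theta> n q) = 1" unfolding part van[OF q order.refl] by simp
      show "\<theta> n q = 0" if "n \<ge> Suc j" for n unfolding \<theta>_def van[OF q that] by simp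
    qed
  qed
qed

section \<open>Tangent vectors and vector fields\<close>

context
  fixes p :: 'a and v assumes v: "v \<in> \<T> p"
begin

lemma deriv_add: "f \<in> \<F> \<Longrightarrow> g \<in> \<F> \<Longrightarrow> v (\<lambda>q. f q + g q) = v f + v g"
  using v by (auto simp: tangent_space_def)

lemma deriv_cmult: "f \<in> \<F> \<Longrightarrow> v (\<lambda>q. c * f q) = c * v f"
  using v by (auto simp: tangent_space_def)

lemma deriv_mult: "f \<in> \<F> \<Longrightarrow> g \<in> \<F> \<Longrightarrow> v (\<lambda>q. f q * g q) = f p * v g + g p * v f"
  using v by (auto simp: tangent_space_def)

lemma deriv_nonsmooth: "f \<notin> \<F> \<Longrightarrow> v f = 0"
  using v by (auto simp: tangent_space_def)

lemma deriv_const: "v (\<lambda>q. c) = 0"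
  using deriv_mult[of "\<lambda>q. 1" "\<lambda>q. 1"] deriv_cmult[of "\<lambda>q. 1" c] by (auto simp: fun_const)

lemma deriv_diff: "f \<in> \<F> \<Longrightarrow> g \<in> \<F> \<Longrightarrow> v (\<lambda>q. f q - g q) = v f - v g"
  using deriv_add[of f "\<lambda>q. -1 * g q"] deriv_cmult[of g "-1"] fun_mult[OF fun_const, of g "-1"]
  by simp

lemma deriv_sum: "(\<And>i. i \<in> I \<Longrightarrow> f i \<in> \<F>) \<Longrightarrow> v (\<lambda>q. \<Sum>i\<in>I. f i q) = (\<Sum>i\<in>I. v (f i))"
  by (induction I rule: infinite_finite_induct) (auto simp: deriv_const deriv_add fun_sum)

text \<open>
  If \<open>f = g\<close> near \<open>p\<close> then \<open>f - g = (1 - \<rho>)(f - g)\<close> for a bump function \<open>\<rho>\<close> at \<open>p\<close>; both factors vanish at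
  \<open>p\<close>, so the product rule kills the right-hand side.
\<close>

lemma deriv_local:
  assumes "f \<in> \<F>" "g \<in> \<F>" "open W" "p \<in> W" "\<And>q. q \<in> W \<Longrightarrow> f q = g q"
  shows "v f = v g"
proof -
  from bump[OF assms(3,4)] obtain \<rho> K V where \<rho>: "\<rho> \<in> \<F>" "K \<subseteq> W" "\<And>q. q \<notin> K \<Longrightarrow> \<rho> q = 0"
    "p \<in> V" "\<And>q. q \<in> V \<Longrightarrow> \<rho> q = (1::real)" by metis
  have "(\<lambda>q. f q - g q) = (\<lambda>q. (1 - \<rho> q) * (f q - g q))"
  proof
    fix q show "f q - g q = (1 - \<rho> q) * (f q - g q)"
      using assms(5)[of q] \<rho>(2) \<rho>(3)[of q] by (cases "q \<in> W") auto
  qed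
  then have "v (\<lambda>q. f q - g q) = v (\<lambda>q. (1 - \<rho> q) * (f q - g q))" by (rule arg_cong)
  also have "\<dots> = (1 - \<rho> p) * v (\<lambda>q. f q - g q) + (f p - g p) * v (\<lambda>q. 1 - \<rho> q)"
    by (intro deriv_mult fun_diff fun_const \<rho> assms)
  also have "\<dots> = 0" using \<rho>(4,5) assms(4,5) by simp
  finally show ?thesis using deriv_diff assms(1,2) by simp
qed

end

lemma tangent_zero: "(\<lambda>f. 0) \<in> \<T> p"
  by (simp add: tangent_space_def)

lemma tangent_lincomb:
  "u \<in> \<T> p \<Longrightarrow> v \<in> \<T> p \<Longrightarrow> (\<lambda>f. a * u f + b * v f) \<in> \<T> p"
  unfolding tangent_space_def by (auto simp: algebra_simps)

lemma tangent_add: "u \<in> \<T> p \<Longrightarrow> v \<in> \<T> p \<Longrightarrow> (\<lambda>f. u f + v f) \<in> \<T> p"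
  using tangent_lincomb[of u p v 1 1] by simp

lemma tangent_scale: "v \<in> \<T> p \<Longrightarrow> (\<lambda>f. a * v f) \<in> \<T> p"
  using tangent_lincomb[of v p v a 0] by simp

lemma tangent_sum:
  "(\<And>i. i \<in> I \<Longrightarrow> e i \<in> \<T> p) \<Longrightarrow> (\<lambda>f. \<Sum>i\<in>I. c i * e i f) \<in> \<T> p"
proof (induction I rule: infinite_finite_induct)
  case (insert i I)
  then show ?case using tangent_lincomb[of "e i" p "\<lambda>f. \<Sum>i\<in>I. c i * e i f" "c i" 1] by simp
qed (auto simp: tangent_zero)

lemma field_tangent: "X \<in> \<X> \<Longrightarrow> X p \<in> \<T> p"
  by (simp add: vector_fields_def)

lemma field_fun: "X \<in> \<X> \<Longrightarrow> f \<in> \<F> \<Longrightarrow> (\<lambda>p. X p f) \<in> \<F>"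
  by (simp add: vector_fields_def)

lemma field_zero: "(\<lambda>p f. 0) \<in> \<X>"
  by (auto simp: vector_fields_def tangent_zero)

lemma field_add: "X \<in> \<X> \<Longrightarrow> Y \<in> \<X> \<Longrightarrow> (\<lambda>p f. X p f + Y p f) \<in> \<X>"
  by (auto simp: vector_fields_def intro: tangent_add)

lemma field_mult: "h \<in> \<F> \<Longrightarrow> X \<in> \<X> \<Longrightarrow> (\<lambda>p f. h p * X p f) \<in> \<X>"
  by (auto simp: vector_fields_def intro: tangent_scale)

lemma field_sum:
  "(\<And>i. i \<in> I \<Longrightarrow> h i \<in> \<F>) \<Longrightarrow> (\<And>i. i \<in> I \<Longrightarrow> E i \<in> \<X>) \<Longrightarrow> (\<lambda>p f. \<Sum>i\<in>I. h i p * E i p f) \<in> \<X>"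
  by (auto simp: vector_fields_def intro!: tangent_sum fun_sum fun_mult)

lemma field_sum1: "(\<And>i. i \<in> I \<Longrightarrow> E i \<in> \<X>) \<Longrightarrow> (\<lambda>p f. \<Sum>i\<in>I. E i p f) \<in> \<X>"
  using field_sum[of I "\<lambda>i q. 1" E] by (simp add: fun_const)

lemma field_local:
  assumes "\<And>p. \<exists>V Y. open V \<and> p \<in> V \<and> Y \<in> \<X> \<and> (\<forall>q\<in>V. X q = Y q)"
  shows "X \<in> \<X>"
proof -
  have "X p \<in> \<T> p" for p using assms[of p] field_tangent by metis
  moreover have "(\<lambda>p. X p f) \<in> \<F>" if "f \<in> \<F>" for f
    by (rule smooth_functions_local) (metis assms field_fun that)
  ultimately show ?thesis by (simp add: vector_fields_def)
qed

lemma field_bracket: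
  assumes XY: "X \<in> \<X>" "Y \<in> \<X>"
  shows "lie_bracket A X Y \<in> \<X>"
  unfolding vector_fields_def
proof (intro CollectI conjI allI ballI)
  note t = field_tangent[OF XY(1)] field_tangent[OF XY(2)]
  show "(\<lambda>p. lie_bracket A X Y p f) \<in> \<F>" if "f \<in> \<F>" for f
    using fun_diff[OF field_fun[OF XY(1) field_fun[OF XY(2) that]] field_fun[OF XY(2) field_fun[OF XY(1) that]]]
    by (simp add: lie_bracket_def that)
  show "lie_bracket A X Y p \<in> \<T> p" for p
    unfolding tangent_space_def
  proof (intro CollectI conjI ballI allI impI)
    fix f g assume f: "f \<in> \<F>" and g: "g \<in> \<F>"
    note XYf = field_fun[OF XY(1) f] field_fun[OF XY(1) g] field_fun[OF XY(2) f] field_fun[OF XY(2) g]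
    show "lie_bracket A X Y p (\<lambda>q. f q + g q) = lie_bracket A X Y p f + lie_bracket A X Y p g"
      using f g XYf by (simp add: lie_bracket_def fun_add deriv_add[OF t(1)] deriv_add[OF t(2)])
    show "lie_bracket A X Y p (\<lambda>q. f q * g q) = f p * lie_bracket A X Y p g + g p * lie_bracket A X Y p f"
      using f g XYf by (simp add: lie_bracket_def fun_mult deriv_add[OF t(1)] deriv_add[OF t(2)]
          deriv_mult[OF t(1)] deriv_mult[OF t(2)] algebra_simps)
  next
    fix f c assume f: "f \<in> \<F>"
    show "lie_bracket A X Y p (\<lambda>q. c * f q) = c * lie_bracket A X Y p f"
      using f field_fun[OF XY(1) f] field_fun[OF XY(2) f]
      by (simp add: lie_bracket_def fun_mult[OF fun_const] deriv_cmult[OF t(1)] deriv_cmult[OF t(2)] algebra_simps)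
  qed (simp add: lie_bracket_def)
qed

section \<open>Frames\<close>

text \<open>
  Coordinate functions and coordinate fields of a chart, cut off so that they are defined on the
  whole manifold, and dual to each other on \<open>W\<close>.
\<close>

definition local_frame :: "'a set \<Rightarrow> ('b \<Rightarrow> 'a \<Rightarrow> real) \<Rightarrow> ('b \<Rightarrow> 'a vfield) \<Rightarrow> bool" where
  "local_frame W x E \<longleftrightarrow> open W \<and> (\<forall>b. x b \<in> \<F> \<and> E b \<in> \<X>) \<and>
     (\<forall>q\<in>W. \<forall>v\<in>\<T> q. \<forall>f. v f = (\<Sum>b\<in>Basis. v (x b) * E b q f)) \<and>
     (\<forall>q\<in>W. \<forall>a\<in>Basis. \<forall>b\<in>Basis. E a q (x b) = (if a = b then 1 else 0))"

text \<open>
  The coordinates and coordinate fields of a chart at \<open>p\<close>, multiplied by a bump function that is \<open>1\<close>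
  on \<open>W\<close>.  The spanning property says that derivations are coordinate vectors: by Hadamard's
  lemma, \<open>f = f(q) + \<Sum>\<^sub>b (x\<^sub>b - x\<^sub>b(q)) G\<^sub>b\<close> near \<open>q\<close>, and a derivation at \<open>q\<close> sends this to \<open>\<Sum>\<^sub>b v(x\<^sub>b) G\<^sub>b(q)\<close>.
\<close>

lemma local_frame_exists:
  obtains W x E where "p \<in> W" "local_frame W x E"
proof -
  obtain U \<phi> where c: "(U, \<phi>) \<in> A" and pU: "p \<in> U" by (rule chart_at)
  let ?i = "inv_into U \<phi>"
  note U = chart(1)[OF c]
  from bump[OF U pU] obtain \<rho> K W where \<rho>: "\<rho> \<in> \<F>" "closed K" "K \<subseteq> U"
    "\<And>q. q \<notin> K \<Longrightarrow> \<rho> q = 0" "open W" "p \<in> W" "W \<subseteq> U" "\<And>q. q \<in> W \<Longrightarrow> \<rho> q = (1::real)" by metis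
  have ext: "(\<lambda>q. if q \<in> U then \<rho> q * g (\<phi> q) else 0) \<in> \<F>" if "smooth_on (\<phi> ` U) g" for g
  proof (rule smooth_chart_extension[OF c U order.refl \<rho>(2,3)])
    show "smooth_on (\<phi> ` U) (\<lambda>y. if ?i y \<in> U then \<rho> (?i y) * g (\<phi> (?i y)) else 0)"
      by (rule smooth_on_cong[OF chart(2)[OF c] _
            smooth_on_mult[OF chart(2)[OF c] smooth_functions_chart[OF \<rho>(1) c] that]]) (use c in auto)
  qed (use \<rho>(4) in auto)
  define x where "x b q = (if q \<in> U then \<rho> q * (\<phi> q \<bullet> b) else 0)" for b q
  define E where "E b q f =
      (if q \<in> U \<and> f \<in> \<F> then \<rho> q * frechet_derivative (\<lambda>y. f (?i y)) (at (\<phi> q)) b else 0)" for b q f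
  have x: "x b \<in> \<F>" for b
    unfolding x_def
    by (rule ext[OF smooth_on_bounded_linear[OF chart(2)[OF c] bounded_linear_inner_left
            smooth_on_ident[OF chart(2)[OF c]]]])
  have hd: "((\<lambda>y. f (?i y)) has_derivative frechet_derivative (\<lambda>y. f (?i y)) (at (\<phi> q))) (at (\<phi> q))"
    if "f \<in> \<F>" "q \<in> U" for f q
    using smooth_on_has_derivative[OF smooth_functions_chart[OF that(1) c]] that(2) by auto
  have E: "E b \<in> \<X>" for b
    unfolding vector_fields_def
  proof (intro CollectI conjI allI ballI)
    show "(\<lambda>q. E b q f) \<in> \<F>" if "f \<in> \<F>" for f
      using ext[OF smooth_on_frechet_derivative[OF smooth_functions_chart[OF that c]]] that
      by (simp add: E_def)
    fix q
    show "E b q \<in> \<T> q"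
    proof (cases "q \<in> U")
      case True
      show ?thesis
        unfolding tangent_space_def
      proof (intro CollectI conjI ballI allI impI)
        fix f g assume f: "f \<in> \<F>" and g: "g \<in> \<F>"
        show "E b q (\<lambda>q. f q + g q) = E b q f + E b q g"
          using fun_cong[OF frechet_derivative_at[OF has_derivative_add[OF hd[OF f True] hd[OF g True]]], of b, symmetric] f g True
          by (simp add: E_def fun_add algebra_simps)
        show "E b q (\<lambda>q. f q * g q) = f q * E b q g + g q * E b q f"
          using fun_cong[OF frechet_derivative_at[OF has_derivative_mult[OF hd[OF f True] hd[OF g True]]], of b, symmetric] f g True c
          by (simp add: E_def fun_mult algebra_simps)
      next
        fix f k assume f: "f \<in> \<F>"
        show "E b q (\<lambda>q. k * f q) = k * E b q f"
          using fun_cong[OF frechet_derivative_at[OF has_derivative_mult_right[OF hd[OF f True], of k]], of b, symmetric] f True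
          by (simp add: E_def fun_mult fun_const algebra_simps)
      qed (simp add: E_def)
    next
      case False
      then have "E b q = (\<lambda>f. 0)" by (auto simp: E_def)
      then show ?thesis by (simp add: tangent_zero)
    qed
  qed
  have dual: "E a q (x b) = (if a = b then 1 else 0)" if q: "q \<in> W" and ab: "a \<in> Basis" "b \<in> Basis" for q a b
  proof -
    have qU: "q \<in> U" using q \<rho>(7) by auto
    have o: "open (\<phi> ` W)" by (rule chart_open_image[OF c \<rho>(5,7)])
    have "((\<lambda>y. x b (?i y)) has_derivative (\<lambda>v. v \<bullet> b)) (at (\<phi> q))"
    proof (rule has_derivative_transform_within_open[OF _ o])
      show "((\<lambda>y. y \<bullet> b) has_derivative (\<lambda>v. v \<bullet> b)) (at (\<phi> q))"
        by (auto intro!: derivative_eq_intros)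
      show "\<phi> q \<in> \<phi> ` W" using q by simp
      show "y \<bullet> b = x b (?i y)" if "y \<in> \<phi> ` W" for y
        using that c \<rho>(7,8) by (auto simp: x_def subset_eq)
    qed
    from fun_cong[OF frechet_derivative_at[OF this], of a, symmetric] show ?thesis
      using qU x \<rho>(8)[OF q] ab by (simp add: E_def inner_Basis)
  qed
  have span: "v f = (\<Sum>b\<in>Basis. v (x b) * E b q f)" if q: "q \<in> W" and v: "v \<in> \<T> q" for q v f
  proof (cases "f \<in> \<F>")
    case False
    then show ?thesis using deriv_nonsmooth[OF v] by (simp add: E_def)
  next
    case True
    have qU: "q \<in> U" using q \<rho>(7) by auto
    have "open (\<phi> ` W)" by (rule chart_open_image[OF c \<rho>(5,7)])
    then obtain r where r: "r > 0" "ball (\<phi> q) r \<subseteq> \<phi> ` W" using q open_contains_ball by (metis imageI)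
    define B where "B = W \<inter> \<phi> -` ball (\<phi> q) r"
    have B: "open B" "q \<in> B" "B \<subseteq> U" "\<phi> ` B = ball (\<phi> q) r"
    proof -
      have "continuous_on W \<phi>"
        using chart(3)[OF c] \<rho>(7) by (auto simp: homeomorphism_def intro: continuous_on_subset)
      then show "open B" unfolding B_def
        using \<rho>(5) by (auto simp: continuous_on_open_vimage Int_commute)
      show "q \<in> B" "B \<subseteq> U" using q r(1) \<rho>(7) by (auto simp: B_def)
      show "\<phi> ` B = ball (\<phi> q) r" using r(2) unfolding B_def by blast
    qed
    have "smooth_on (ball (\<phi> q) r) (\<lambda>y. f (?i y))"
      using smooth_on_subset[OF smooth_functions_chart[OF True c] image_mono[OF B(3)]]
      unfolding B(4) .
    from Hadamard[OF this] obtain g where g: "\<And>b. smooth_on (ball (\<phi> q) r) (g b)"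
      "\<And>y. y \<in> ball (\<phi> q) r \<Longrightarrow> f (?i y) = f (?i (\<phi> q)) + (\<Sum>b\<in>Basis. ((y - \<phi> q) \<bullet> b) * g b y)"
      "\<And>b. g b (\<phi> q) = frechet_derivative (\<lambda>y. f (?i y)) (at (\<phi> q)) b" by blast
    from bump[OF B(1,2)] obtain \<sigma> L V where \<sigma>: "\<sigma> \<in> \<F>" "closed L" "L \<subseteq> B"
      "\<And>q. q \<notin> L \<Longrightarrow> \<sigma> q = 0" "open V" "q \<in> V" "V \<subseteq> B" "\<And>q. q \<in> V \<Longrightarrow> \<sigma> q = (1::real)" by metis
    define G where "G b q = (if q \<in> B then \<sigma> q * g b (\<phi> q) else 0)" for b q
    have G: "G b \<in> \<F>" for b
    proof (rule smooth_chart_extension[OF c B(1,3) \<sigma>(2,3)])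
      have o: "open (\<phi> ` B)" unfolding B(4) by simp
      show "smooth_on (\<phi> ` B) (\<lambda>y. G b (?i y))"
        by (rule smooth_on_cong[OF o _ smooth_on_mult[OF o smooth_on_subset[OF
              smooth_functions_chart[OF \<sigma>(1) c]] g(1)[of b, folded B(4)]]])
           (use c B(3) in \<open>auto simp: G_def subset_eq\<close>)
    qed (use \<sigma>(4) in \<open>auto simp: G_def\<close>)
    have loc: "f q' = f q + (\<Sum>b\<in>Basis. (x b q' - x b q) * G b q')" if "q' \<in> V" for q'
    proof -
      have q': "q' \<in> B" "q' \<in> W" "q' \<in> U" using that \<sigma>(7) B(3) by (auto simp: B_def)
      have "\<phi> q' \<in> ball (\<phi> q) r" using q'(1) by (auto simp: B_def)
      from g(2)[OF this] show ?thesis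
        using q' qU c \<sigma>(8)[OF that] \<rho>(8)[OF q'(2)] \<rho>(8)[OF q]
        by (simp add: x_def G_def inner_diff_left)
    qed
    have xd: "(\<lambda>q'. (x b q' - x b q) * G b q') \<in> \<F>" for b
      using x G by (intro fun_mult fun_diff fun_const)
    have "v f = v (\<lambda>q'. f q + (\<Sum>b\<in>Basis. (x b q' - x b q) * G b q'))"
      using loc by (intro deriv_local[OF v True _ \<sigma>(5,6)] fun_add fun_const fun_sum xd) auto
    also have "\<dots> = (\<Sum>b\<in>Basis. v (\<lambda>q'. (x b q' - x b q) * G b q'))"
      by (simp add: deriv_add[OF v] deriv_const[OF v] deriv_sum[OF v] fun_const fun_sum xd)
    also have "\<dots> = (\<Sum>b\<in>Basis. v (x b) * E b q f)"
    proof (rule sum.cong[OF refl])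
      fix b :: 'b
      have "v (\<lambda>q'. (x b q' - x b q) * G b q') = G b q * v (x b)"
        using deriv_mult[OF v fun_diff[OF x fun_const] G] deriv_diff[OF v x fun_const]
          deriv_const[OF v] by simp
      also have "G b q = E b q f"
        using \<sigma>(6,8) \<rho>(8)[OF q] B(2) g(3) qU True by (simp add: G_def E_def)
      finally show "v (\<lambda>q'. (x b q' - x b q) * G b q') = v (x b) * E b q f" by simp
    qed
    finally show ?thesis .
  qed
  show thesis
    by (rule that[of W x E]) (use \<rho>(5,6) x E dual span in \<open>auto simp: local_frame_def\<close>)
qed

lemma tangent_extends:
  assumes "v \<in> \<T> p"
  obtains X where "X \<in> \<X>" "X p = v"
proof -
  obtain W x E where "p \<in> W" and fr: "local_frame W x E" by (rule local_frame_exists)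
  then show thesis using assms
    by (intro that[of "\<lambda>q f. \<Sum>b\<in>Basis. v (x b) * E b q f"] field_sum)
       (auto simp: local_frame_def)
qed

text \<open>
  The fields of the local frames are weighted with a partition of unity; the functions are not.
\<close>

lemma global_frame:
  obtains x :: "nat \<Rightarrow> 'b \<Rightarrow> 'a \<Rightarrow> real" and E :: "nat \<Rightarrow> 'b \<Rightarrow> 'a vfield"
  where "\<And>n b. x n b \<in> \<F>" "\<And>n b. E n b \<in> \<X>"
    "\<And>p. \<exists>V m. open V \<and> p \<in> V \<and> (\<forall>q\<in>V. (\<forall>n\<ge>m. \<forall>b. E n b q = (\<lambda>f. 0)) \<and>
        (\<forall>v\<in>\<T> q. \<forall>f. v f = (\<Sum>n<m. \<Sum>b\<in>Basis. v (x n b) * E n b q f)))"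
proof -
  obtain W x E where W: "\<And>p. p \<in> W p" and fr: "\<And>p. local_frame (W p) (x p) (E p)"
  proof -
    have "\<exists>W x E. p \<in> W \<and> local_frame W x E" for p
      by (rule local_frame_exists[of p]) auto
    then show thesis using that by metis
  qed
  have op: "open (W p)" for p using fr by (simp add: local_frame_def)
  obtain \<theta> :: "nat \<Rightarrow> 'a \<Rightarrow> real" and c :: "nat \<Rightarrow> 'a" where
    \<theta>: "\<And>n. \<theta> n \<in> \<F>" "\<And>n q. q \<notin> W (c n) \<Longrightarrow> \<theta> n q = 0"
      "\<And>p. \<exists>V m. open V \<and> p \<in> V \<and> (\<forall>q\<in>V. (\<forall>n\<ge>m. \<theta> n q = 0) \<and> (\<Sum>n<m. \<theta> n q) = 1)"
    by (rule partition_of_unity[of W, OF op W]) (rule that)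
  show thesis
  proof (rule that[of "\<lambda>n. x (c n)" "\<lambda>n b q f. \<theta> n q * E (c n) b q f"])
    show "x (c n) b \<in> \<F>" for n b using fr by (simp add: local_frame_def)
    show "(\<lambda>q f. \<theta> n q * E (c n) b q f) \<in> \<X>" for n b
      using fr by (intro field_mult \<theta>) (simp add: local_frame_def)
    fix p
    obtain V m where V: "open V" "p \<in> V" "\<forall>q\<in>V. (\<forall>n\<ge>m. \<theta> n q = 0) \<and> (\<Sum>n<m. \<theta> n q) = 1"
      using \<theta>(3)[of p] by blast
    have "v f = (\<Sum>n<m. \<Sum>b\<in>Basis. v (x (c n) b) * (\<theta> n q * E (c n) b q f))"
      if q: "q \<in> V" and v: "v \<in> \<T> q" for q v f
    proof -
      have "\<theta> n q * v f = (\<Sum>b\<in>Basis. v (x (c n) b) * (\<theta> n q * E (c n) b q f))" for n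
      proof (cases "q \<in> W (c n)")
        case True
        then have "v f = (\<Sum>b\<in>Basis. v (x (c n) b) * E (c n) b q f)"
          using fr v by (simp add: local_frame_def)
        then show ?thesis by (simp add: sum_distrib_left mult_ac)
      qed (simp add: \<theta>(2))
      then have "(\<Sum>n<m. \<Sum>b\<in>Basis. v (x (c n) b) * (\<theta> n q * E (c n) b q f)) = (\<Sum>n<m. \<theta> n q * v f)"
        by simp
      also have "\<dots> = v f" using V(3) q by (simp flip: sum_distrib_right)
      finally show ?thesis by simp
    qed
    then show "\<exists>V m. open V \<and> p \<in> V \<and> (\<forall>q\<in>V. (\<forall>n\<ge>m. \<forall>b. (\<lambda>f. \<theta> n q * E (c n) b q f) = (\<lambda>f. 0)) \<and>
        (\<forall>v\<in>\<T> q. \<forall>f. v f = (\<Sum>n<m. \<Sum>b\<in>Basis. v (x (c n) b) * (\<theta> n q * E (c n) b q f))))"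
      using V by (intro exI[of _ V] exI[of _ m]) auto
  qed
qed

section \<open>A symmetric connection\<close>

text \<open>
  \<open>D\<^sub>X Y = \<Sum>\<^sub>n\<^sub>,\<^sub>b X(Y(x\<^sub>n\<^sub>b)) E\<^sub>n\<^sub>b\<close> for a global frame.  Expanding \<open>X(h Y(x))\<close> by the product rule leaves the
  extra term \<open>X(h) \<Sum> Y(x\<^sub>n\<^sub>b) E\<^sub>n\<^sub>b = X(h) Y\<close>, which is the Leibniz rule; and
  \<open>D\<^sub>X Y - D\<^sub>Y X = \<Sum> [X, Y](x\<^sub>n\<^sub>b) E\<^sub>n\<^sub>b = [X, Y]\<close>.
\<close>

lemma symmetric_connection_exists:
  obtains D where "symmetric_connection A D"
proof -
  obtain x :: "nat \<Rightarrow> 'b \<Rightarrow> 'a \<Rightarrow> real" and E :: "nat \<Rightarrow> 'b \<Rightarrow> 'a vfield"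
    where x: "\<And>n b. x n b \<in> \<F>" and E: "\<And>n b. E n b \<in> \<X>"
    and loc: "\<And>p. \<exists>V m. open V \<and> p \<in> V \<and> (\<forall>q\<in>V. (\<forall>n\<ge>m::nat. \<forall>b. E n b q = (\<lambda>f. 0)) \<and>
        (\<forall>v\<in>\<T> q. \<forall>f. v f = (\<Sum>n<m. \<Sum>b\<in>Basis. v (x n b) * E n b q f)))"
    by (rule global_frame) (rule that)
  define S where "S X Y p f = (\<Sum>n. \<Sum>b\<in>Basis. X p (\<lambda>q. Y q (x n b)) * E n b p f)"
    for X Y :: "'a vfield" and p f
  define D where "D X Y = (if X \<in> \<X> \<and> Y \<in> \<X> then S X Y else (\<lambda>p f. 0))" for X Y
  have fin: "S X Y q f = (\<Sum>n<m. \<Sum>b\<in>Basis. X q (\<lambda>q. Y q (x n b)) * E n b q f)"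
    if "\<forall>n\<ge>m. \<forall>b. E n b q = (\<lambda>f. 0)" for X Y q f m
    unfolding S_def using that by (intro suminf_finite) auto
  have pt: "\<exists>m. (\<forall>X Y f. S X Y p f = (\<Sum>n<m. \<Sum>b\<in>Basis. X p (\<lambda>q. Y q (x n b)) * E n b p f)) \<and>
      (\<forall>v\<in>\<T> p. \<forall>f. v f = (\<Sum>n<m. \<Sum>b\<in>Basis. v (x n b) * E n b p f))" for p
  proof -
    obtain V m where "p \<in> V" "\<forall>q\<in>V. (\<forall>n\<ge>m::nat. \<forall>b. E n b q = (\<lambda>f. 0)) \<and>
        (\<forall>v\<in>\<T> q. \<forall>f. v f = (\<Sum>n<m. \<Sum>b\<in>Basis. v (x n b) * E n b q f))"
      using loc[of p] by blast
    then show ?thesis using fin[of m p] by (intro exI[of _ m]) blast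
  qed
  have S: "S X Y \<in> \<X>" if X: "X \<in> \<X>" and Y: "Y \<in> \<X>" for X Y
  proof (rule field_local)
    fix p
    obtain V m where V: "open V" "p \<in> V" "\<forall>q\<in>V. \<forall>n\<ge>m::nat. \<forall>b. E n b q = (\<lambda>f. 0)"
      using loc[of p] by blast
    have "(\<lambda>q f. \<Sum>n<m. \<Sum>b\<in>Basis. X q (\<lambda>q. Y q (x n b)) * E n b q f) \<in> \<X>"
      by (intro field_sum1 field_sum field_fun[OF X] field_fun[OF Y] x E)
    moreover have "S X Y q = (\<lambda>f. \<Sum>n<m. \<Sum>b\<in>Basis. X q (\<lambda>q. Y q (x n b)) * E n b q f)"
      if "q \<in> V" for q
      using fin[of m q X Y] V(3) that by (intro ext) blast
    ultimately show "\<exists>V Z. open V \<and> p \<in> V \<and> Z \<in> \<X> \<and> (\<forall>q\<in>V. S X Y q = Z q)"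
      using V(1,2) by blast
  qed
  have "connection A D"
    unfolding connection_def
  proof (intro conjI ballI allI impI)
    show "D X Y \<in> \<X>" if "X \<in> \<X>" "Y \<in> \<X>" for X Y using that S by (simp add: D_def)
    show "D X Y = (\<lambda>p f. 0)" if "X \<notin> \<X> \<or> Y \<notin> \<X>" for X Y using that by (auto simp: D_def)
  next
    fix X X' Y assume X: "X \<in> \<X>" "X' \<in> \<X>" and Y: "Y \<in> \<X>"
    have "S (\<lambda>p f. X p f + X' p f) Y p f = S X Y p f + S X' Y p f" for p f
    proof -
      obtain m where "\<forall>X Y f. S X Y p f = (\<Sum>n<m. \<Sum>b\<in>Basis. X p (\<lambda>q. Y q (x n b)) * E n b p f)"
        using pt by blast
      then show ?thesis by (simp add: distrib_right sum.distrib)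
    qed
    then have "S (\<lambda>p f. X p f + X' p f) Y = (\<lambda>p f. S X Y p f + S X' Y p f)" by (intro ext)
    then show "D (\<lambda>p f. X p f + X' p f) Y = (\<lambda>p f. D X Y p f + D X' Y p f)"
      using X Y by (simp add: D_def field_add)
  next
    fix h X Y assume h: "h \<in> \<F>" and X: "X \<in> \<X>" and Y: "Y \<in> \<X>"
    have "S (\<lambda>p f. h p * X p f) Y p f = h p * S X Y p f" for p f
    proof -
      obtain m where "\<forall>X Y f. S X Y p f = (\<Sum>n<m. \<Sum>b\<in>Basis. X p (\<lambda>q. Y q (x n b)) * E n b p f)"
        using pt by blast
      then show ?thesis by (simp add: sum_distrib_left mult.assoc)
    qed
    then have "S (\<lambda>p f. h p * X p f) Y = (\<lambda>p f. h p * S X Y p f)" by (intro ext)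
    then show "D (\<lambda>p f. h p * X p f) Y = (\<lambda>p f. h p * D X Y p f)"
      using h X Y by (simp add: D_def field_mult)
  next
    fix X Y Y' assume X: "X \<in> \<X>" and Y: "Y \<in> \<X>" "Y' \<in> \<X>"
    have "S X (\<lambda>p f. Y p f + Y' p f) p f = S X Y p f + S X Y' p f" for p f
    proof -
      obtain m where m: "\<forall>X Y f. S X Y p f = (\<Sum>n<m. \<Sum>b\<in>Basis. X p (\<lambda>q. Y q (x n b)) * E n b p f)"
        using pt by blast
      have "X p (\<lambda>q. Y q (x n b) + Y' q (x n b)) = X p (\<lambda>q. Y q (x n b)) + X p (\<lambda>q. Y' q (x n b))"
        for n b by (rule deriv_add[OF field_tangent[OF X] field_fun[OF Y(1) x] field_fun[OF Y(2) x]])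
      then show ?thesis by (simp add: m distrib_right sum.distrib)
    qed
    then have "S X (\<lambda>p f. Y p f + Y' p f) = (\<lambda>p f. S X Y p f + S X Y' p f)" by (intro ext)
    then show "D X (\<lambda>p f. Y p f + Y' p f) = (\<lambda>p f. D X Y p f + D X Y' p f)"
      using X Y by (simp add: D_def field_add)
  next
    fix h X Y assume h: "h \<in> \<F>" and X: "X \<in> \<X>" and Y: "Y \<in> \<X>"
    have "S X (\<lambda>p f. h p * Y p f) p f = X p h * Y p f + h p * S X Y p f" for p f
    proof -
      obtain m where m: "\<forall>X Y f. S X Y p f = (\<Sum>n<m. \<Sum>b\<in>Basis. X p (\<lambda>q. Y q (x n b)) * E n b p f)"
        and span: "\<forall>v\<in>\<T> p. \<forall>f. v f = (\<Sum>n<m. \<Sum>b\<in>Basis. v (x n b) * E n b p f)"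
        using pt by blast
      have "X p (\<lambda>q. h q * Y q (x n b)) = h p * X p (\<lambda>q. Y q (x n b)) + Y p (x n b) * X p h"
        for n b by (rule deriv_mult[OF field_tangent[OF X] h field_fun[OF Y x]])
      then have "S X (\<lambda>p f. h p * Y p f) p f
          = h p * S X Y p f + X p h * (\<Sum>n<m. \<Sum>b\<in>Basis. Y p (x n b) * E n b p f)"
        by (simp add: m algebra_simps sum.distrib sum_distrib_left)
      then show ?thesis using span field_tangent[OF Y] by simp
    qed
    then have "S X (\<lambda>p f. h p * Y p f) = (\<lambda>p f. X p h * Y p f + h p * S X Y p f)" by (intro ext)
    then show "D X (\<lambda>p f. h p * Y p f) = (\<lambda>p f. X p h * Y p f + h p * D X Y p f)"
      using h X Y by (simp add: D_def field_mult)
  qed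
  moreover have "torsion A D X Y = (\<lambda>p f. 0)" if X: "X \<in> \<X>" and Y: "Y \<in> \<X>" for X Y
  proof (intro ext)
    fix p f
    obtain m where m: "\<forall>X Y f. S X Y p f = (\<Sum>n<m. \<Sum>b\<in>Basis. X p (\<lambda>q. Y q (x n b)) * E n b p f)"
      and span: "\<forall>v\<in>\<T> p. \<forall>f. v f = (\<Sum>n<m. \<Sum>b\<in>Basis. v (x n b) * E n b p f)"
      using pt by blast
    have "lie_bracket A X Y p f = (\<Sum>n<m. \<Sum>b\<in>Basis. lie_bracket A X Y p (x n b) * E n b p f)"
      using span field_tangent[OF field_bracket[OF X Y]] by blast
    also have "\<dots> = S X Y p f - S Y X p f"
      by (simp add: m lie_bracket_def x left_diff_distrib sum_subtractf)
    finally show "torsion A D X Y p f = 0" using X Y by (simp add: torsion_def D_def)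
  qed
  ultimately show thesis by (intro that[of D]) (simp add: symmetric_connection_def)
qed

text \<open>
  The case distinction gives the sum the prescribed value \<open>0\<close> on arguments that are not smooth
  vector fields.
\<close>

lemma symmetric_connection_add_tensor:
  assumes D: "symmetric_connection A D"
    and S: "\<And>X Y. X \<in> \<X> \<Longrightarrow> Y \<in> \<X> \<Longrightarrow> S X Y \<in> \<X>"
    and sym: "\<And>X Y. X \<in> \<X> \<Longrightarrow> Y \<in> \<X> \<Longrightarrow> S X Y = S Y X"
    and add: "\<And>X X' Y. X \<in> \<X> \<Longrightarrow> X' \<in> \<X> \<Longrightarrow> Y \<in> \<X> \<Longrightarrow>
      S (\<lambda>p f. X p f + X' p f) Y = (\<lambda>p f. S X Y p f + S X' Y p f)"
    and mult: "\<And>h X Y. h \<in> \<F> \<Longrightarrow> X \<in> \<X> \<Longrightarrow> Y \<in> \<X> \<Longrightarrow>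
      S (\<lambda>p f. h p * X p f) Y = (\<lambda>p f. h p * S X Y p f)"
  shows "symmetric_connection A
    (\<lambda>X Y. if X \<in> \<X> \<and> Y \<in> \<X> then (\<lambda>p f. D X Y p f + S X Y p f) else (\<lambda>p f. 0))"
    (is "symmetric_connection A ?D")
proof -
  have c: "connection A D" and t: "\<And>X Y. X \<in> \<X> \<Longrightarrow> Y \<in> \<X> \<Longrightarrow> torsion A D X Y = (\<lambda>p f. 0)"
    using D by (auto simp: symmetric_connection_def)
  have "connection A ?D"
    unfolding connection_def
  proof (intro conjI ballI allI impI)
    show "?D X Y \<in> \<X>" if "X \<in> \<X>" "Y \<in> \<X>" for X Y
      using that S c by (simp add: connection_def field_add)
    show "?D X Y = (\<lambda>p f. 0)" if "X \<notin> \<X> \<or> Y \<notin> \<X>" for X Y using that by auto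
  next
    fix X X' Y assume "X \<in> \<X>" "X' \<in> \<X>" "Y \<in> \<X>"
    then show "?D (\<lambda>p f. X p f + X' p f) Y = (\<lambda>p f. ?D X Y p f + ?D X' Y p f)"
      using c by (simp add: connection_def field_add add algebra_simps)
  next
    fix h X Y assume "h \<in> \<F>" "X \<in> \<X>" "Y \<in> \<X>"
    then show "?D (\<lambda>p f. h p * X p f) Y = (\<lambda>p f. h p * ?D X Y p f)"
      using c by (simp add: connection_def field_mult mult algebra_simps)
  next
    fix X Y Y' assume XY: "X \<in> \<X>" "Y \<in> \<X>" "Y' \<in> \<X>"
    then have "S X (\<lambda>p f. Y p f + Y' p f) = (\<lambda>p f. S X Y p f + S X Y' p f)"
      using sym[of X "\<lambda>p f. Y p f + Y' p f"] sym[of X Y] sym[of X Y'] by (simp add: add field_add)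
    with XY show "?D X (\<lambda>p f. Y p f + Y' p f) = (\<lambda>p f. ?D X Y p f + ?D X Y' p f)"
      using c by (simp add: connection_def field_add algebra_simps)
  next
    fix h X Y assume hXY: "h \<in> \<F>" "X \<in> \<X>" "Y \<in> \<X>"
    then have "S X (\<lambda>p f. h p * Y p f) = (\<lambda>p f. h p * S X Y p f)"
      using sym[of X "\<lambda>p f. h p * Y p f"] sym[of X Y] by (simp add: mult field_mult)
    with hXY show "?D X (\<lambda>p f. h p * Y p f) = (\<lambda>p f. X p h * Y p f + h p * ?D X Y p f)"
      using c by (simp add: connection_def field_mult algebra_simps)
  qed
  moreover have "torsion A ?D X Y = (\<lambda>p f. 0)" if "X \<in> \<X>" "Y \<in> \<X>" for X Y
    using t[OF that] sym[OF that] that by (simp add: torsion_def fun_eq_iff)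
  ultimately show ?thesis by (simp add: symmetric_connection_def)
qed

section \<open>Linear systems with smooth coefficients\<close>

text \<open>
  Gaussian elimination, by induction on the index set: with \<open>r = 1 / M\<^sub>k\<^sub>k\<close> near \<open>p\<close>, the unknown \<open>y\<^sub>k\<close> is
  eliminated and the Schur complement \<open>M\<^sub>i\<^sub>j - M\<^sub>i\<^sub>k M\<^sub>k\<^sub>j r\<close> is again the identity matrix at \<open>p\<close>.  The
  normalisation at \<open>p\<close> makes every pivot nonzero, so no rows need to be exchanged.
\<close>

lemma solve_near_identity:
  fixes M :: "'i \<Rightarrow> 'i \<Rightarrow> 'a \<Rightarrow> real" and \<alpha> :: "'i \<Rightarrow> 'a \<Rightarrow> real"
  assumes "finite I" and "\<And>i j. i \<in> I \<Longrightarrow> j \<in> I \<Longrightarrow> M i j \<in> \<F>"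
    and "\<And>i j. i \<in> I \<Longrightarrow> j \<in> I \<Longrightarrow> M i j p = (if i = j then 1 else 0)"
    and "\<And>j. j \<in> I \<Longrightarrow> \<alpha> j \<in> \<F>"
  shows "\<exists>y W. open W \<and> p \<in> W \<and> (\<forall>i\<in>I. y i \<in> \<F>) \<and>
    (\<forall>q\<in>W. \<forall>j\<in>I. (\<Sum>i\<in>I. y i q * M i j q) = \<alpha> j q)"
  using assms
proof (induction I arbitrary: M \<alpha> rule: finite_induct)
  case empty
  show ?case by (auto intro: exI[of _ UNIV])
next
  case (insert k I)
  have "M k k \<in> \<F>" "M k k p \<noteq> 0" using insert.prems by auto
  then obtain r U where r: "r \<in> \<F>" "open U" "p \<in> U" "\<And>q. q \<in> U \<Longrightarrow> M k k q * r q = 1"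
    by (rule local_reciprocal) (rule that)
  \<comment> \<open>the system that remains after substituting \<open>z\<close> below for the unknown with index \<open>k\<close>\<close>
  define M' where "M' i j q = M i j q - M i k q * (M k j q * r q)" for i j q
  define \<alpha>' where "\<alpha>' j q = \<alpha> j q - \<alpha> k q * (M k j q * r q)" for j q
  have "\<exists>y W. open W \<and> p \<in> W \<and> (\<forall>i\<in>I. y i \<in> \<F>) \<and>
    (\<forall>q\<in>W. \<forall>j\<in>I. (\<Sum>i\<in>I. y i q * M' i j q) = \<alpha>' j q)"
  proof (rule insert.IH)
    fix i j assume ij: "i \<in> I" "j \<in> I"
    show "M' i j \<in> \<F>"
      unfolding M'_def using ij insert.prems(1) r(1) by (intro fun_diff fun_mult) auto
    show "M' i j p = (if i = j then 1 else 0)"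
      using ij insert.prems(2) insert.hyps(2) by (auto simp: M'_def)
    show "\<alpha>' j \<in> \<F>"
      unfolding \<alpha>'_def using ij insert.prems(1,3) r(1) by (intro fun_diff fun_mult) auto
  qed
  then obtain y W where y: "open W" "p \<in> W" "\<And>i. i \<in> I \<Longrightarrow> y i \<in> \<F>"
    "\<And>q j. q \<in> W \<Longrightarrow> j \<in> I \<Longrightarrow> (\<Sum>i\<in>I. y i q * M' i j q) = \<alpha>' j q" by blast
  define z where "z = (\<lambda>q. (\<alpha> k q - (\<Sum>i\<in>I. y i q * M i k q)) * r q)"
  define y' where "y' i = (if i = k then z else y i)" for i
  have "z \<in> \<F>"
    unfolding z_def using insert.prems(1,3) y(3) r(1)
    by (intro fun_mult fun_diff fun_sum) auto
  then have "y' i \<in> \<F>" if "i \<in> insert k I" for i using that y(3) by (auto simp: y'_def)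
  moreover have "(\<Sum>i\<in>insert k I. y' i q * M i j q) = \<alpha> j q" if q: "q \<in> W \<inter> U" and j: "j \<in> insert k I" for q j
  proof -
    have "(\<Sum>i\<in>I. y' i q * M i j q) = (\<Sum>i\<in>I. y i q * M i j q)"
      using insert.hyps(2) by (intro sum.cong) (auto simp: y'_def)
    then have e: "(\<Sum>i\<in>insert k I. y' i q * M i j q) = z q * M k j q + (\<Sum>i\<in>I. y i q * M i j q)"
      using insert.hyps by (simp add: y'_def)
    have z: "z q * M k j q = (\<alpha> k q - (\<Sum>i\<in>I. y i q * M i k q)) * (M k j q * r q)"
      by (simp add: z_def mult_ac)
    show ?thesis
    proof (cases "j = k")
      case True
      then have "M k j q * r q = 1" using r(4)[of q] q by simp
      then show ?thesis unfolding e z using True by simp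
    next
      case False
      then have "(\<Sum>i\<in>I. y i q * M' i j q) = \<alpha>' j q" using y(4) q j by auto
      then have "(\<Sum>i\<in>I. y i q * M i j q) - (\<Sum>i\<in>I. y i q * M i k q) * (M k j q * r q)
          = \<alpha> j q - \<alpha> k q * (M k j q * r q)"
        by (simp add: M'_def \<alpha>'_def right_diff_distrib sum_subtractf sum_distrib_right mult.assoc)
      then show ?thesis unfolding e z by (simp add: algebra_simps)
    qed
  qed
  ultimately show ?case using y(1,2) r(2,3)
    by (intro exI[of _ y'] exI[of _ "W \<inter> U"]) auto
qed

text \<open>
  Multiplying by the constant matrix inverse to \<open>M(p)\<close> reduces to the case of the identity at \<open>p\<close>.
\<close>

lemma solve_linear_system:
  fixes M :: "'b \<Rightarrow> 'b \<Rightarrow> 'a \<Rightarrow> real"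
  assumes M: "\<And>a b. M a b \<in> \<F>" and \<alpha>: "\<And>b. \<alpha> b \<in> \<F>"
    and nondeg: "\<And>u::'b. (\<And>b. b \<in> Basis \<Longrightarrow> (\<Sum>a\<in>Basis. (u \<bullet> a) * M a b p) = 0) \<Longrightarrow> u = 0"
  obtains y W where "open W" "p \<in> W" "\<And>a. y a \<in> \<F>"
    "\<And>q b. q \<in> W \<Longrightarrow> b \<in> Basis \<Longrightarrow> (\<Sum>a\<in>Basis. y a q * M a b q) = \<alpha> b q"
proof -
  define L :: "'b \<Rightarrow> 'b" where "L u = (\<Sum>b\<in>Basis. (\<Sum>a\<in>Basis. (u \<bullet> a) * M a b p) *\<^sub>R b)" for u
  have comp: "L u \<bullet> b = (\<Sum>a\<in>Basis. (u \<bullet> a) * M a b p)" if "b \<in> Basis" for u b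
    using that by (simp add: L_def)
  have lin: "linear L"
    by (rule linearI)
       (simp_all add: L_def inner_add_left distrib_right sum.distrib scaleR_add_left
         scaleR_sum_right sum_distrib_left mult.assoc)
  have "inj L"
    unfolding linear_injective_0[OF lin]
  proof (intro allI impI nondeg)
    show "(\<Sum>a\<in>Basis. (u \<bullet> a) * M a b p) = 0" if "L u = 0" "b \<in> Basis" for u b
      using comp[OF that(2), of u] that(1) by simp
  qed
  then have "surj L" using linear_injective_imp_surjective[OF lin] by simp
  then obtain c where c: "\<And>k. L (c k) = k" by (metis surjD)
  define M' where "M' k b q = (\<Sum>a\<in>Basis. (c k \<bullet> a) * M a b q)" for k b q
  have "\<exists>y W. open W \<and> p \<in> W \<and> (\<forall>i\<in>Basis. y i \<in> \<F>) \<and>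
    (\<forall>q\<in>W. \<forall>j\<in>Basis. (\<Sum>i\<in>Basis. y i q * M' i j q) = \<alpha> j q)"
  proof (rule solve_near_identity)
    show "M' i j \<in> \<F>" for i j
      unfolding M'_def by (intro fun_sum fun_mult fun_const M)
    show "M' i j p = (if i = j then 1 else 0)" if "i \<in> Basis" "j \<in> Basis" for i j
      using comp[OF that(2), of "c i"] c that by (simp add: M'_def inner_Basis)
  qed (auto simp: \<alpha>)
  then obtain y W where y: "open W" "p \<in> W" "\<And>k. k \<in> Basis \<Longrightarrow> y k \<in> \<F>"
    "\<And>q b. q \<in> W \<Longrightarrow> b \<in> Basis \<Longrightarrow> (\<Sum>k\<in>Basis. y k q * M' k b q) = \<alpha> b q" by blast
  show thesis
  proof (rule that[of W "\<lambda>a q. \<Sum>k\<in>Basis. y k q * (c k \<bullet> a)"])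
    show "(\<lambda>q. \<Sum>k\<in>Basis. y k q * (c k \<bullet> a)) \<in> \<F>" for a
      by (intro fun_sum fun_mult fun_const y)
    fix q and b :: 'b assume qb: "q \<in> W" "b \<in> Basis"
    have "(\<Sum>a\<in>Basis. (\<Sum>k\<in>Basis. y k q * (c k \<bullet> a)) * M a b q)
        = (\<Sum>a\<in>Basis. \<Sum>k\<in>Basis. y k q * ((c k \<bullet> a) * M a b q))"
      by (simp add: sum_distrib_right mult.assoc)
    also have "\<dots> = (\<Sum>k\<in>Basis. y k q * M' k b q)"
      by (subst sum.swap) (simp add: M'_def sum_distrib_left)
    finally show "(\<Sum>a\<in>Basis. (\<Sum>k\<in>Basis. y k q * (c k \<bullet> a)) * M a b q) = \<alpha> b q"
      using y(4)[OF qb] by simp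
  qed (use y in auto)
qed

end

section \<open>Nondegenerate two-forms\<close>

locale nondegenerate_form = smooth_manifold A
  for A :: "('a::{t2_space, second_countable_topology}, 'b::euclidean_space) atlas" +
  fixes \<omega> :: "'a \<Rightarrow> 'a tvec \<Rightarrow> 'a tvec \<Rightarrow> real"
  assumes form: "two_form A \<omega>" and nondeg: "nondegenerate A \<omega>"
begin

lemma form_smooth: "X \<in> \<X> \<Longrightarrow> Y \<in> \<X> \<Longrightarrow> (\<lambda>p. \<omega> p (X p) (Y p)) \<in> \<F>"
  using form by (simp add: two_form_def)

lemma form_lincomb:
  assumes "u \<in> \<T> p" "v \<in> \<T> p" "w \<in> \<T> p"
  shows "\<omega> p (\<lambda>f. a * u f + b * v f) w = a * \<omega> p u w + b * \<omega> p v w"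
    and "\<omega> p w (\<lambda>f. a * u f + b * v f) = a * \<omega> p w u + b * \<omega> p w v"
  using form assms by (auto simp: two_form_def)

lemma form_add:
  assumes "u \<in> \<T> p" "v \<in> \<T> p" "w \<in> \<T> p"
  shows "\<omega> p (\<lambda>f. u f + v f) w = \<omega> p u w + \<omega> p v w"
    and "\<omega> p w (\<lambda>f. u f + v f) = \<omega> p w u + \<omega> p w v"
  using form_lincomb[OF assms, of 1 1] by simp_all

lemma form_diff:
  assumes "u \<in> \<T> p" "v \<in> \<T> p" "w \<in> \<T> p"
  shows "\<omega> p (\<lambda>f. u f - v f) w = \<omega> p u w - \<omega> p v w"
  using form_lincomb[OF assms, of 1 "-1"] by simp_all

lemma form_scale:
  assumes "u \<in> \<T> p" "w \<in> \<T> p"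
  shows "\<omega> p (\<lambda>f. a * u f) w = a * \<omega> p u w" and "\<omega> p w (\<lambda>f. a * u f) = a * \<omega> p w u"
  using form_lincomb[OF assms(1,1,2), of a 0] by simp_all

lemma form_skew:
  assumes "u \<in> \<T> p" "v \<in> \<T> p"
  shows "\<omega> p u v = - \<omega> p v u"
proof -
  have alt: "\<omega> p w w = 0" if "w \<in> \<T> p" for w using form that by (simp add: two_form_def)
  have "0 = \<omega> p (\<lambda>f. u f + v f) (\<lambda>f. u f + v f)" using alt[OF tangent_add[OF assms]] by simp
  also have "\<dots> = \<omega> p u v + \<omega> p v u"
    by (simp add: form_add[OF assms tangent_add[OF assms]] form_add[OF assms] assms alt)
  finally show ?thesis by simp
qed

lemma form_sum:
  assumes w: "w \<in> \<T> p" and e: "\<And>i. i \<in> I \<Longrightarrow> e i \<in> \<T> p"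
  shows "\<omega> p (\<lambda>f. \<Sum>i\<in>I. c i * e i f) w = (\<Sum>i\<in>I. c i * \<omega> p (e i) w)"
  using e
proof (induction I rule: infinite_finite_induct)
  case (insert i I)
  have "\<omega> p (\<lambda>f. c i * e i f + 1 * (\<Sum>i\<in>I. c i * e i f)) w
      = c i * \<omega> p (e i) w + 1 * \<omega> p (\<lambda>f. \<Sum>i\<in>I. c i * e i f) w"
    by (rule form_lincomb(1)) (use insert.prems in \<open>auto intro!: tangent_sum w\<close>)
  then show ?case using insert by simp
qed (use form_scale(1)[OF tangent_zero w, of 0] in auto)

text \<open>
  Nondegeneracy only tests against tangent vectors at \<open>p\<close>, but each of them is the value of a
  vector field.
\<close>

lemma form_unique:
  assumes "u \<in> \<T> p" "v \<in> \<T> p" and eq: "\<And>Z. Z \<in> \<X> \<Longrightarrow> \<omega> p u (Z p) = \<omega> p v (Z p)"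
  shows "u = v"
proof -
  have "\<omega> p (\<lambda>f. u f - v f) w = 0" if w: "w \<in> \<T> p" for w
  proof -
    obtain Z where "Z \<in> \<X>" "Z p = w" using tangent_extends[OF w] by blast
    then show ?thesis using eq[of Z] by (simp add: form_diff[OF assms(1,2) w])
  qed
  moreover have "(\<lambda>f. u f - v f) \<in> \<T> p" using tangent_lincomb[OF assms(1,2), of 1 "-1"] by simp
  ultimately have "(\<lambda>f. u f - v f) = (\<lambda>f. 0)" using nondeg by (simp add: nondegenerate_def)
  then show ?thesis by (simp add: fun_eq_iff)
qed

lemma field_form_unique:
  assumes "X \<in> \<X>" "Y \<in> \<X>" and "\<And>Z p. Z \<in> \<X> \<Longrightarrow> \<omega> p (X p) (Z p) = \<omega> p (Y p) (Z p)"
  shows "X = Y"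
proof
  show "X p = Y p" for p
    by (rule form_unique[OF field_tangent[OF assms(1)] field_tangent[OF assms(2)]]) (rule assms(3))
qed

text \<open>
  Near a point, \<open>N = \<Sum>\<^sub>a y\<^sub>a E\<^sub>a\<close>, where the coefficients solve \<open>\<Sum>\<^sub>a y\<^sub>a \<omega>(E\<^sub>a, E\<^sub>b) = \<alpha>(E\<^sub>b)\<close>.
  Testing on the frame is enough: \<open>C\<^sup>\<infinity>\<close>-linearity makes \<open>\<alpha>(Z)\<close> at \<open>q\<close> depend only on the expansion
  of \<open>Z\<close> in the frame near \<open>q\<close>.  Local solutions agree where both are defined, by \<open>form_unique\<close>, and
  hence glue.
\<close>

lemma sharp:
  fixes \<alpha> :: "'a vfield \<Rightarrow> 'a \<Rightarrow> real"
  assumes sm: "\<And>Z. Z \<in> \<X> \<Longrightarrow> \<alpha> Z \<in> \<F>"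
    and add: "\<And>Z Z' p. Z \<in> \<X> \<Longrightarrow> Z' \<in> \<X> \<Longrightarrow> \<alpha> (\<lambda>p f. Z p f + Z' p f) p = \<alpha> Z p + \<alpha> Z' p"
    and mult: "\<And>h Z p. h \<in> \<F> \<Longrightarrow> Z \<in> \<X> \<Longrightarrow> \<alpha> (\<lambda>p f. h p * Z p f) p = h p * \<alpha> Z p"
  shows "\<exists>N\<in>\<X>. \<forall>Z\<in>\<X>. \<forall>p. \<omega> p (N p) (Z p) = \<alpha> Z p"
proof -
  have sum: "\<alpha> (\<lambda>p f. \<Sum>i\<in>I. h i p * Z i p f) q = (\<Sum>i\<in>I. h i q * \<alpha> (Z i) q)"
    if "\<And>i. h i \<in> \<F>" "\<And>i. Z i \<in> \<X>" for I :: "'b set" and h Z q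
  proof (induction I rule: infinite_finite_induct)
    case (insert i I)
    have "\<alpha> (\<lambda>p f. h i p * Z i p f + (\<Sum>i\<in>I. h i p * Z i p f)) q
        = \<alpha> (\<lambda>p f. h i p * Z i p f) q + \<alpha> (\<lambda>p f. \<Sum>i\<in>I. h i p * Z i p f) q"
      by (intro add field_mult field_sum that)
    then show ?case using insert by (simp add: mult that)
  qed (use mult[OF fun_const field_zero, of 0] in auto)
  have loc: "\<exists>W N. open W \<and> p \<in> W \<and> N \<in> \<X> \<and> (\<forall>q\<in>W. \<forall>Z\<in>\<X>. \<omega> q (N q) (Z q) = \<alpha> Z q)" for p
  proof -
    obtain U x E where p: "p \<in> U" and fr: "local_frame U x E" by (rule local_frame_exists)
    have U: "open U" and x: "\<And>b. x b \<in> \<F>" and E: "\<And>b. E b \<in> \<X>"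
      and span: "\<And>q v f. q \<in> U \<Longrightarrow> v \<in> \<T> q \<Longrightarrow> v f = (\<Sum>b\<in>Basis. v (x b) * E b q f)"
      and dual: "\<And>q a b. q \<in> U \<Longrightarrow> a \<in> Basis \<Longrightarrow> b \<in> Basis \<Longrightarrow> E a q (x b) = (if a = b then 1 else 0)"
      using fr by (auto simp: local_frame_def)
    note Et = field_tangent[OF E]
    have expand: "\<omega> q w v = (\<Sum>b\<in>Basis. v (x b) * \<omega> q w (E b q))"
      if "q \<in> U" "v \<in> \<T> q" "w \<in> \<T> q" for q v w
    proof -
      have "v = (\<lambda>f. \<Sum>b\<in>Basis. v (x b) * E b q f)" using span[OF that(1,2)] by blast
      then have "\<omega> q v w = (\<Sum>b\<in>Basis. v (x b) * \<omega> q (E b q) w)"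
        using form_sum[OF that(3), of Basis "\<lambda>b. E b q" "\<lambda>b. v (x b)"] Et by simp
      then show ?thesis
        using form_skew[OF that(3,2)] form_skew[OF Et that(3)] by (simp add: sum_negf)
    qed
    \<comment> \<open>a kernel vector of the matrix at \<open>p\<close> gives a tangent vector in the kernel of \<open>\<omega>\<close>\<close>
    have nd: "u = 0" if u: "\<And>b. b \<in> Basis \<Longrightarrow> (\<Sum>a\<in>Basis. (u \<bullet> a) * \<omega> p (E a p) (E b p)) = 0" for u :: 'b
    proof -
      define w where "w = (\<lambda>f. \<Sum>a\<in>Basis. (u \<bullet> a) * E a p f)"
      have w: "w \<in> \<T> p" unfolding w_def by (intro tangent_sum Et)
      have "\<omega> p w (E b p) = 0" if "b \<in> Basis" for b
        using u[OF that] form_sum[OF Et, where e = "\<lambda>a. E a p" and c = "\<lambda>a. u \<bullet> a"] Et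
        by (simp add: w_def)
      then have "\<omega> p w v = 0" if "v \<in> \<T> p" for v using expand[OF p that w] by simp
      then have "w = (\<lambda>f. 0)" using nondeg w by (simp add: nondegenerate_def)
      then have "(\<Sum>a\<in>Basis. (u \<bullet> a) * E a p (x b)) = 0" for b by (simp add: w_def fun_eq_iff)
      moreover have "(\<Sum>a\<in>Basis. (u \<bullet> a) * E a p (x b)) = u \<bullet> b" if "b \<in> Basis" for b
        using that dual[OF p] by (simp add: if_distrib[of "\<lambda>t. _ * t"] cong: if_cong)
      ultimately show ?thesis by (metis euclidean_eq_iff inner_zero_left)
    qed
    obtain y W where y: "open W" "p \<in> W" "\<And>a. y a \<in> \<F>"
      "\<And>q b. q \<in> W \<Longrightarrow> b \<in> Basis \<Longrightarrow> (\<Sum>a\<in>Basis. y a q * \<omega> q (E a q) (E b q)) = \<alpha> (E b) q"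
    proof (rule solve_linear_system[of "\<lambda>a b q. \<omega> q (E a q) (E b q)" "\<lambda>b. \<alpha> (E b)" p])
      show "(\<lambda>q. \<omega> q (E a q) (E b q)) \<in> \<F>" for a b by (rule form_smooth[OF E E])
      show "\<alpha> (E b) \<in> \<F>" for b by (rule sm[OF E])
    qed (use nd that in blast)+
    define N where "N = (\<lambda>q f. \<Sum>a\<in>Basis. y a q * E a q f)"
    have N: "N \<in> \<X>" unfolding N_def by (intro field_sum y E)
    have NE: "\<omega> q (N q) (E b q) = \<alpha> (E b) q" if "q \<in> W" "b \<in> Basis" for q b
      using y(4)[OF that] form_sum[OF Et, where e = "\<lambda>a. E a q" and c = "\<lambda>a. y a q"] Et
      by (simp add: N_def)
    have "\<omega> q (N q) (Z q) = \<alpha> Z q" if q: "q \<in> U \<inter> W" and Z: "Z \<in> \<X>" for q Z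
    proof -
      from q have qU: "q \<in> U" by simp
      from bump[OF U qU] obtain \<rho> K V where \<rho>: "\<rho> \<in> \<F>" "K \<subseteq> U" "\<And>q. q \<notin> K \<Longrightarrow> \<rho> q = 0"
        "q \<in> V" "\<And>q. q \<in> V \<Longrightarrow> \<rho> q = (1::real)" by metis
      \<comment> \<open>a cut-off of \<open>Z\<close>, which is unchanged at \<open>q\<close>, expands globally in the frame\<close>
      have eq: "(\<lambda>p f. \<rho> p * Z p f) = (\<lambda>p f. \<Sum>b\<in>Basis. (\<rho> p * Z p (x b)) * E b p f)"
      proof (intro ext)
        fix p f
        show "\<rho> p * Z p f = (\<Sum>b\<in>Basis. (\<rho> p * Z p (x b)) * E b p f)"
        proof (cases "p \<in> U")
          case True
          show ?thesis
            by (subst span[OF True field_tangent[OF Z]]) (simp add: sum_distrib_left mult.assoc)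
        next
          case False
          then have "\<rho> p = 0" using \<rho>(2,3) by blast
          then show ?thesis by simp
        qed
      qed
      have "\<alpha> Z q = \<alpha> (\<lambda>p f. \<rho> p * Z p f) q" using \<rho>(4,5) by (simp add: mult[OF \<rho>(1) Z])
      also have "\<dots> = (\<Sum>b\<in>Basis. (\<rho> q * Z q (x b)) * \<alpha> (E b) q)"
        unfolding eq by (intro sum fun_mult \<rho>(1) field_fun[OF Z] x E)
      also have "\<dots> = (\<Sum>b\<in>Basis. Z q (x b) * \<omega> q (N q) (E b q))"
        using \<rho>(4,5) NE q by simp
      also have "\<dots> = \<omega> q (N q) (Z q)"
        using expand[OF qU field_tangent[OF Z] field_tangent[OF N]] by simp
      finally show ?thesis by simp
    qed
    then show ?thesis using U p y(1,2) N by (intro exI[of _ "U \<inter> W"] exI[of _ N]) auto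
  qed
  then obtain W N where W: "\<And>p. open (W p)" "\<And>p. p \<in> W p" and N: "\<And>p. N p \<in> \<X>"
    and NZ: "\<And>p q Z. q \<in> W p \<Longrightarrow> Z \<in> \<X> \<Longrightarrow> \<omega> q (N p q) (Z q) = \<alpha> Z q" by metis
  have eq: "N q q = N p q" if "q \<in> W p" for p q
    by (rule form_unique[OF field_tangent[OF N] field_tangent[OF N]]) (simp add: NZ W(2) that)
  have "(\<lambda>q. N q q) \<in> \<X>"
    by (rule field_local) (metis W N eq)
  then show ?thesis using NZ W(2) by (intro bexI[of _ "\<lambda>q. N q q"]) auto
qed

section \<open>Covariant derivatives of the form\<close>

context
  fixes D assumes D: "symmetric_connection A D"
begin

lemma conn_field: "X \<in> \<X> \<Longrightarrow> Y \<in> \<X> \<Longrightarrow> D X Y \<in> \<X>"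
  using D by (simp add: symmetric_connection_def connection_def)

lemma conn_tangent: "X \<in> \<X> \<Longrightarrow> Y \<in> \<X> \<Longrightarrow> D X Y p \<in> \<T> p"
  by (intro field_tangent conn_field)

lemma bracket_eq:
  assumes "X \<in> \<X>" "Y \<in> \<X>"
  shows "lie_bracket A X Y p = (\<lambda>f. D X Y p f - D Y X p f)"
proof -
  have "torsion A D X Y = (\<lambda>p f. 0)" using D assms by (simp add: symmetric_connection_def)
  then show ?thesis by (simp add: torsion_def fun_eq_iff)
qed

text \<open>
  Zero torsion turns each bracket into a difference of covariant derivatives; the six
  resulting terms are those of the three covariant derivatives of \<open>\<omega>\<close>.
\<close>

lemma ext_deriv_eq_alternated_cov_deriv:
  assumes X: "X \<in> \<X>" and Y: "Y \<in> \<X>" and Z: "Z \<in> \<X>"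
  shows "ext_deriv A \<omega> X Y Z p
    = cov_deriv D \<omega> X Y Z p - cov_deriv D \<omega> Y X Z p + cov_deriv D \<omega> Z X Y p"
proof -
  note t = field_tangent[OF X] field_tangent[OF Y] field_tangent[OF Z]
  have "\<omega> p (lie_bracket A X Y p) (Z p) = \<omega> p (D X Y p) (Z p) - \<omega> p (D Y X p) (Z p)"
    "\<omega> p (lie_bracket A X Z p) (Y p) = \<omega> p (D X Z p) (Y p) - \<omega> p (D Z X p) (Y p)"
    "\<omega> p (lie_bracket A Y Z p) (X p) = \<omega> p (D Y Z p) (X p) - \<omega> p (D Z Y p) (X p)"
    by (simp_all add: bracket_eq X Y Z form_diff conn_tangent t)
  moreover have "\<omega> p (Y p) (D X Z p) = - \<omega> p (D X Z p) (Y p)"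
    "\<omega> p (X p) (D Y Z p) = - \<omega> p (D Y Z p) (X p)"
    "\<omega> p (X p) (D Z Y p) = - \<omega> p (D Z Y p) (X p)"
    by (intro form_skew t conn_tangent X Y Z)+
  ultimately show ?thesis by (simp add: ext_deriv_def cov_deriv_def)
qed

lemma cov_deriv_smooth:
  assumes X: "X \<in> \<X>" and Y: "Y \<in> \<X>" and Z: "Z \<in> \<X>"
  shows "cov_deriv D \<omega> X Y Z \<in> \<F>"
  unfolding cov_deriv_def
  by (intro fun_diff field_fun[OF X] form_smooth conn_field X Y Z)

lemma cov_deriv_skew:
  assumes X: "X \<in> \<X>" and Y: "Y \<in> \<X>" and Z: "Z \<in> \<X>"
  shows "cov_deriv D \<omega> X Y Z p = - cov_deriv D \<omega> X Z Y p"
proof -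
  note t = field_tangent[OF X] field_tangent[OF Y] field_tangent[OF Z]
  have "(\<lambda>q. \<omega> q (Y q) (Z q)) = (\<lambda>q. -1 * \<omega> q (Z q) (Y q))"
    using form_skew[OF field_tangent[OF Y] field_tangent[OF Z]] by (simp add: fun_eq_iff)
  then have "X p (\<lambda>q. \<omega> q (Y q) (Z q)) = -1 * X p (\<lambda>q. \<omega> q (Z q) (Y q))"
    using deriv_cmult[OF t(1) form_smooth[OF Z Y], where c = "-1"] by simp
  moreover have "\<omega> p (D X Y p) (Z p) = - \<omega> p (Z p) (D X Y p)"
    "\<omega> p (Y p) (D X Z p) = - \<omega> p (D X Z p) (Y p)"
    by (intro form_skew t conn_tangent X Y Z)+
  ultimately show ?thesis by (simp add: cov_deriv_def)
qed

lemma cov_deriv_add1: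
  assumes "X \<in> \<X>" "X' \<in> \<X>" "Y \<in> \<X>" "Z \<in> \<X>"
  shows "cov_deriv D \<omega> (\<lambda>p f. X p f + X' p f) Y Z p
    = cov_deriv D \<omega> X Y Z p + cov_deriv D \<omega> X' Y Z p"
proof -
  have "D (\<lambda>p f. X p f + X' p f) W = (\<lambda>p f. D X W p f + D X' W p f)" if "W \<in> \<X>" for W
    using D assms that by (simp add: symmetric_connection_def connection_def)
  then show ?thesis
    using assms by (simp add: cov_deriv_def form_add conn_tangent field_tangent)
qed

lemma cov_deriv_mult1:
  assumes "h \<in> \<F>" "X \<in> \<X>" "Y \<in> \<X>" "Z \<in> \<X>"
  shows "cov_deriv D \<omega> (\<lambda>p f. h p * X p f) Y Z p = h p * cov_deriv D \<omega> X Y Z p"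
proof -
  have "D (\<lambda>p f. h p * X p f) W = (\<lambda>p f. h p * D X W p f)" if "W \<in> \<X>" for W
    using D assms that by (simp add: symmetric_connection_def connection_def)
  then show ?thesis
    using assms by (simp add: cov_deriv_def form_scale conn_tangent field_tangent right_diff_distrib)
qed

lemma cov_deriv_add2:
  assumes "X \<in> \<X>" "Y \<in> \<X>" "Y' \<in> \<X>" "Z \<in> \<X>"
  shows "cov_deriv D \<omega> X (\<lambda>p f. Y p f + Y' p f) Z p
    = cov_deriv D \<omega> X Y Z p + cov_deriv D \<omega> X Y' Z p"
proof -
  have "D X (\<lambda>p f. Y p f + Y' p f) = (\<lambda>p f. D X Y p f + D X Y' p f)"
    using D assms by (simp add: symmetric_connection_def connection_def)
  moreover have "X p (\<lambda>q. \<omega> q (Y q) (Z q) + \<omega> q (Y' q) (Z q))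
      = X p (\<lambda>q. \<omega> q (Y q) (Z q)) + X p (\<lambda>q. \<omega> q (Y' q) (Z q))"
    by (intro deriv_add[OF field_tangent[OF assms(1)]] form_smooth assms)
  ultimately show ?thesis
    using assms by (simp add: cov_deriv_def form_add conn_tangent field_tangent)
qed

text \<open>
  Tensoriality: the derivative of \<open>h\<close> that arises from \<open>X(h \<omega>(Y, Z))\<close> is cancelled by the one that
  the Leibniz rule produces in \<open>\<omega>(D\<^sub>X(h Y), Z)\<close>.
\<close>

lemma cov_deriv_mult2:
  assumes "h \<in> \<F>" "X \<in> \<X>" "Y \<in> \<X>" "Z \<in> \<X>"
  shows "cov_deriv D \<omega> X (\<lambda>p f. h p * Y p f) Z p = h p * cov_deriv D \<omega> X Y Z p"
proof -
  note t = field_tangent[OF assms(2)] field_tangent[OF assms(3)] field_tangent[OF assms(4)]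
  have "D X (\<lambda>p f. h p * Y p f) = (\<lambda>p f. X p h * Y p f + h p * D X Y p f)"
    using D assms by (simp add: symmetric_connection_def connection_def)
  moreover have "\<omega> p (\<lambda>f. X p h * Y p f + h p * D X Y p f) (Z p)
      = X p h * \<omega> p (Y p) (Z p) + h p * \<omega> p (D X Y p) (Z p)"
    by (intro form_lincomb t conn_tangent assms)
  moreover have "X p (\<lambda>q. h q * \<omega> q (Y q) (Z q))
      = h p * X p (\<lambda>q. \<omega> q (Y q) (Z q)) + \<omega> p (Y p) (Z p) * X p h"
    by (intro deriv_mult[OF t(1)] form_smooth assms)
  ultimately show ?thesis
    using assms by (simp add: cov_deriv_def form_scale conn_tangent field_tangent algebra_simps)
qed

end

section \<open>Compatible symmetric connections\<close>

text \<open>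
  The last sign comes from \<open>\<omega>(Y, S(X, Z)) = - \<omega>(S(X, Z), Y)\<close>, so that every occurrence of \<open>S\<close> is
  in the first slot, where it will be known.
\<close>

lemma cov_deriv_add_tensor:
  assumes D: "symmetric_connection A D"
    and S: "\<And>X Y. X \<in> \<X> \<Longrightarrow> Y \<in> \<X> \<Longrightarrow> S X Y \<in> \<X>"
    and X: "X \<in> \<X>" and Y: "Y \<in> \<X>" and Z: "Z \<in> \<X>"
  shows "cov_deriv (\<lambda>X Y. if X \<in> \<X> \<and> Y \<in> \<X> then (\<lambda>p f. D X Y p f + S X Y p f) else (\<lambda>p f. 0)) \<omega> X Y Z p
    = cov_deriv D \<omega> X Y Z p - \<omega> p (S X Y p) (Z p) + \<omega> p (S X Z p) (Y p)"
proof -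
  note t = field_tangent[OF X] field_tangent[OF Y] field_tangent[OF Z]
  have "\<omega> p (Y p) (S X Z p) = - \<omega> p (S X Z p) (Y p)"
    by (intro form_skew t field_tangent[OF S] X Z)
  then show ?thesis
    using X Y Z by (simp add: cov_deriv_def form_add conn_tangent[OF D] t field_tangent[OF S])
qed

lemma compatible_imp_closed:
  assumes D: "symmetric_connection A D" and "compatible A D \<omega>"
  shows "closed_form A \<omega>"
  using assms(2) by (simp add: closed_form_def compatible_def fun_eq_iff ext_deriv_eq_alternated_cov_deriv[OF D])

text \<open>
  Adding \<open>S\<close> changes \<open>T(X, Y, Z)\<close> by \<open>- \<omega>(S(X, Y), Z) + \<omega>(S(X, Z), Y)\<close>.  With the given \<open>S\<close> and the skew
  symmetry of \<open>T\<close>, the new covariant derivative is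
  \<open>(T(X, Y, Z) - T(Y, X, Z) + T(Z, X, Y)) / 3 = d\<omega>(X, Y, Z) / 3\<close>.
\<close>

lemma closed_imp_compatible_exists:
  assumes closed: "closed_form A \<omega>"
  obtains D where "symmetric_connection A D" "compatible A D \<omega>"
proof -
  obtain D where D: "symmetric_connection A D" by (rule symmetric_connection_exists)
  let ?T = "cov_deriv D \<omega>"
  note sm = cov_deriv_smooth[OF D] and skew = cov_deriv_skew[OF D]
    and add1 = cov_deriv_add1[OF D] and add2 = cov_deriv_add2[OF D]
    and mult1 = cov_deriv_mult1[OF D] and mult2 = cov_deriv_mult2[OF D]
  have add3: "?T X Y (\<lambda>p f. Z p f + Z' p f) p = ?T X Y Z p + ?T X Y Z' p"
    if "X \<in> \<X>" "Y \<in> \<X>" "Z \<in> \<X>" "Z' \<in> \<X>" for X Y Z Z' p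
    using that skew[of X Y "\<lambda>p f. Z p f + Z' p f" p] skew[of X Y Z p] skew[of X Y Z' p]
    by (simp add: add2 field_add)
  have mult3: "?T X Y (\<lambda>p f. h p * Z p f) p = h p * ?T X Y Z p"
    if "h \<in> \<F>" "X \<in> \<X>" "Y \<in> \<X>" "Z \<in> \<X>" for h X Y Z p
    using that skew[of X Y "\<lambda>p f. h p * Z p f" p] skew[of X Y Z p]
    by (simp add: mult2 field_mult)
  have "\<exists>N\<in>\<X>. \<forall>Z\<in>\<X>. \<forall>p. \<omega> p (N p) (Z p) = (1/3) * (?T X Y Z p + ?T Y X Z p)"
    if X: "X \<in> \<X>" and Y: "Y \<in> \<X>" for X Y
  proof (rule sharp)
    show "(\<lambda>p. (1/3) * (?T X Y Z p + ?T Y X Z p)) \<in> \<F>" if "Z \<in> \<X>" for Z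
      by (intro fun_mult fun_add fun_const sm X Y that)
  qed (simp_all add: add3 mult3 X Y algebra_simps)
  then obtain S where S: "\<And>X Y. X \<in> \<X> \<Longrightarrow> Y \<in> \<X> \<Longrightarrow> S X Y \<in> \<X>"
    and \<omega>S: "\<And>X Y Z p. X \<in> \<X> \<Longrightarrow> Y \<in> \<X> \<Longrightarrow> Z \<in> \<X> \<Longrightarrow>
      \<omega> p (S X Y p) (Z p) = (1/3) * (?T X Y Z p + ?T Y X Z p)" by metis
  let ?D = "\<lambda>X Y. if X \<in> \<X> \<and> Y \<in> \<X> then (\<lambda>p f. D X Y p f + S X Y p f) else (\<lambda>p f. 0)"
  have "symmetric_connection A ?D"
  proof (rule symmetric_connection_add_tensor[where S = S, OF D S])
    show "S X Y = S Y X" if "X \<in> \<X>" "Y \<in> \<X>" for X Y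
      by (rule field_form_unique) (simp_all add: S \<omega>S that)
    show "S (\<lambda>p f. X p f + X' p f) Y = (\<lambda>p f. S X Y p f + S X' Y p f)"
      if "X \<in> \<X>" "X' \<in> \<X>" "Y \<in> \<X>" for X X' Y
      using that by (intro field_form_unique)
        (simp_all add: S field_add \<omega>S form_add field_tangent add1 add2 algebra_simps)
    show "S (\<lambda>p f. h p * X p f) Y = (\<lambda>p f. h p * S X Y p f)"
      if "h \<in> \<F>" "X \<in> \<X>" "Y \<in> \<X>" for h X Y
      using that by (intro field_form_unique)
        (simp_all add: S field_mult \<omega>S form_scale field_tangent mult1 mult2 algebra_simps)
  qed
  moreover have "compatible A ?D \<omega>"
    unfolding compatible_def
  proof (intro ballI ext)
    fix X Y Z p assume X: "X \<in> \<X>" and Y: "Y \<in> \<X>" and Z: "Z \<in> \<X>"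
    have "?T X Y Z p - ?T Y X Z p + ?T Z X Y p = 0"
      using closed X Y Z ext_deriv_eq_alternated_cov_deriv[OF D X Y Z, of p]
      by (simp add: closed_form_def)
    then show "cov_deriv ?D \<omega> X Y Z p = 0"
      using cov_deriv_add_tensor[where S = S, OF D S X Y Z, of p] \<omega>S[OF X Y Z, of p] \<omega>S[OF X Z Y, of p]
        skew[OF X Z Y, of p] by (simp add: field_simps)
  qed
  ultimately show thesis by (rule that)
qed

text \<open>
  The connections \<open>D + S\<^sub>t\<close> with \<open>S\<^sub>t(X, Y) = t \<omega>(V, X) \<omega>(V, Y) V\<close> are distinct, as \<open>V\<close> is nonzero at
  \<open>p\<close> and by nondegeneracy some \<open>X\<^sub>0\<close> has \<open>\<omega>(V, X\<^sub>0) \<noteq> 0\<close> there.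
\<close>

lemma infinitely_many_compatible:
  assumes D: "symmetric_connection A D" and comp: "compatible A D \<omega>"
  shows "infinite {D. symmetric_connection A D \<and> compatible A D \<omega>}"
proof -
  fix p :: 'a
  obtain W x E where "p \<in> W" and fr: "local_frame W x E" by (rule local_frame_exists)
  obtain b :: 'b where b: "b \<in> Basis" using nonempty_Basis by blast
  define V where "V = E b"
  have V: "V \<in> \<X>" using fr by (simp add: V_def local_frame_def)
  have Vp: "V p (x b) = 1" using fr \<open>p \<in> W\<close> b by (simp add: V_def local_frame_def)
  note Vt = field_tangent[OF V]
  have "\<exists>w\<in>\<T> p. \<omega> p (V p) w \<noteq> 0"
  proof (rule ccontr)
    assume "\<not> ?thesis"
    then have "V p = (\<lambda>f. 0)" using nondeg Vt unfolding nondegenerate_def by blast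
    then show False using Vp by simp
  qed
  then obtain X0 where X0: "X0 \<in> \<X>" "\<omega> p (V p) (X0 p) \<noteq> 0"     by (metis tangent_extends)
  define S where "S t X Y = (\<lambda>p f. (t * (\<omega> p (V p) (X p) * \<omega> p (V p) (Y p))) * V p f)"
    for t :: real and X Y :: "'a vfield"
  define D' where "D' t X Y =
    (if X \<in> \<X> \<and> Y \<in> \<X> then (\<lambda>p f. D X Y p f + S t X Y p f) else (\<lambda>p f. 0))" for t X Y
  have S: "S t X Y \<in> \<X>" if "X \<in> \<X>" "Y \<in> \<X>" for t X Y
    unfolding S_def by (intro field_mult fun_mult fun_const form_smooth V that)
  have "symmetric_connection A (D' t)" for t
    unfolding D'_def
  proof (rule symmetric_connection_add_tensor[where S = "S t", OF D S])
    show "S t X Y = S t Y X" for X Y by (simp add: S_def mult_ac)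
    show "S t (\<lambda>p f. X p f + X' p f) Y = (\<lambda>p f. S t X Y p f + S t X' Y p f)"
      if "X \<in> \<X>" "X' \<in> \<X>" for X X' Y
      using that by (simp add: S_def form_add Vt field_tangent algebra_simps)
    show "S t (\<lambda>p f. h p * X p f) Y = (\<lambda>p f. h p * S t X Y p f)" if "X \<in> \<X>" for h X Y
      using that by (simp add: S_def form_scale Vt field_tangent algebra_simps)
  qed
  moreover have "compatible A (D' t) \<omega>" for t
    unfolding compatible_def
  proof (intro ballI ext)
    fix X Y Z p assume X: "X \<in> \<X>" and Y: "Y \<in> \<X>" and Z: "Z \<in> \<X>"
    have "cov_deriv D \<omega> X Y Z p = 0" using comp X Y Z by (simp add: compatible_def)
    then show "cov_deriv (D' t) \<omega> X Y Z p = 0"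
      using cov_deriv_add_tensor[where S = "S t", OF D S X Y Z, of p]
      by (simp add: D'_def[abs_def] S_def form_scale Vt field_tangent[OF Y] field_tangent[OF Z])
  qed
  ultimately have "range (\<lambda>n::nat. D' (real n)) \<subseteq> {D. symmetric_connection A D \<and> compatible A D \<omega>}"
    by auto
  moreover have "inj (\<lambda>n::nat. D' (real n))"
  proof (rule injI)
    fix m n :: nat assume "D' (real m) = D' (real n)"
    then have "D' (real m) X0 X0 p (x b) = D' (real n) X0 X0 p (x b)" by simp
    then show "m = n" using X0 Vp by (simp add: D'_def S_def)
  qed
  ultimately show ?thesis using range_inj_infinite finite_subset by blast
qed

end

theorem lemma2p3:
  fixes A :: "('a::{t2_space, second_countable_topology}, 'b::euclidean_space) atlas"
    and \<omega> :: "'a \<Rightarrow> 'a tvec \<Rightarrow> 'a tvec \<Rightarrow> real"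
  assumes "smooth_atlas A"
    and "two_form A \<omega>"
    and "nondegenerate A \<omega>"
  shows "((\<exists>D. symmetric_connection A D \<and> compatible A D \<omega>) \<longleftrightarrow> closed_form A \<omega>) \<and>
         (closed_form A \<omega> \<longrightarrow> infinite {D. symmetric_connection A D \<and> compatible A D \<omega>})"
proof -
  interpret nondegenerate_form A \<omega>
    by unfold_locales (fact assms)+
  have exists: "\<exists>D. symmetric_connection A D \<and> compatible A D \<omega>" if "closed_form A \<omega>"
    by (rule closed_imp_compatible_exists[OF that]) blast
  show ?thesis
    using compatible_imp_closed exists infinitely_many_compatible by blast
qed

end
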